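(* Let $G$ be a graph without loops and let $M=\{\{x_1,y_1\},\dots,\{x_t,y_t\}\}$ be a perfect matching of $G$ with Property $P$ such that for $2\le i\le t$, $N_G(x_i)\cap\{x_1,y_1,\dots,x_{i-1},y_{i-1}\}=\emptyset$. Let $(h_0,h_1,\dots)$ be the $h$-vector of $R/I(G)$. Then $h_i$ is the number of independent subsets of $M$ of size $i$.
   Context: All graphs are finite. For a field $k$, $R$ is the polynomial ring over $k$ with variables the vertices of $G$, and the edge ideal is $I(G)=\langle uv \mid \{u,v\}\in E(G)\rangle\subseteq R$. The neighbor set is $N_G(v)=\{u\mid \{u,v\}\in E(G)\}$. A matching is a set of pairwise disjoint edges; it is perfect if every vertex of $G$ lies in one of its edges. Property $P$: an edge $\{x,y\}\in E(G)$ has Property $P$ if for any $a,b\in V(G)$ with $\{a,x\},\{y,b\}\in E(G)$ we have $a\neq b$ and $\{a,b\}\in E(G)$. A perfect matching has Property $P$ if every edge in it has Property $P$. A subset of $M$ is independent if no two of its edges are connected by an edge of $G$, i.e. the subset is an induced matching of $G$. $h$-vector: writing $\sum_{s\ge0}\dim_k(R/I(G))_s t^s=\frac{h_0+h_1t+\cdots+h_dt^d}{(1-t)^d}$ with $d=\dim(R/I(G))$, the $h$-vector is $(h_0,\dots,h_d)$. *)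

theory Defs
  imports
    "HOL-Algebra.Algebra"
    "HOL-Library.Poly_Mapping"
    "HOL-Library.Extended_Nat"
    "HOL-Computational_Algebra.Formal_Power_Series"
begin

section \<open>Graphs and matchings\<close>

text \<open>An edge is the set of its endpoints, so a loop at \<open>v\<close> is the singleton \<open>{v}\<close>.\<close>

definition finite_graph :: "'v set \<Rightarrow> 'v set set \<Rightarrow> bool" where
  "finite_graph V E \<longleftrightarrow> finite V \<and> (\<forall>e\<in>E. \<exists>u\<in>V. \<exists>v\<in>V. e = {u, v})"

definition loopless :: "'v set set \<Rightarrow> bool" where
  "loopless E \<longleftrightarrow> (\<forall>v. {v} \<notin> E)"

definition neighbors :: "'v set set \<Rightarrow> 'v \<Rightarrow> 'v set" where
  "neighbors E v = {u. {u, v} \<in> E}"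

definition matching :: "'v set set \<Rightarrow> 'v set set \<Rightarrow> bool" where
  "matching E M \<longleftrightarrow> M \<subseteq> E \<and> (\<forall>e\<in>M. \<forall>f\<in>M. e \<noteq> f \<longrightarrow> e \<inter> f = {})"

definition perfect_matching :: "'v set \<Rightarrow> 'v set set \<Rightarrow> 'v set set \<Rightarrow> bool" where
  "perfect_matching V E M \<longleftrightarrow> matching E M \<and> (\<forall>v\<in>V. \<exists>e\<in>M. v \<in> e)"

definition edge_property_P :: "'v set \<Rightarrow> 'v set set \<Rightarrow> 'v set \<Rightarrow> bool" where
  "edge_property_P V E e \<longleftrightarrow>
     (\<forall>x y. e = {x, y} \<longrightarrow>
       (\<forall>a\<in>V. \<forall>b\<in>V. {a, x} \<in> E \<and> {y, b} \<in> E \<longrightarrow> a \<noteq> b \<and> {a, b} \<in> E))"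

definition property_P :: "'v set \<Rightarrow> 'v set set \<Rightarrow> 'v set set \<Rightarrow> bool" where
  "property_P V E M \<longleftrightarrow> (\<forall>e\<in>M. edge_property_P V E e)"

definition independent_edges :: "'v set set \<Rightarrow> 'v set set \<Rightarrow> bool" where
  "independent_edges E S \<longleftrightarrow>
     (\<forall>e\<in>S. \<forall>f\<in>S. e \<noteq> f \<longrightarrow> \<not> (\<exists>u\<in>e. \<exists>v\<in>f. {u, v} \<in> E))"


section \<open>The polynomial ring and the edge ideal\<close>

text \<open>A monomial is a finitely supported exponent function \<open>'v \<Rightarrow>\<^sub>0 nat\<close>, and a polynomial is a
  finitely supported coefficient function on monomials, multiplied by convolution.\<close>

type_synonym ('v, 'k) mpoly = "('v \<Rightarrow>\<^sub>0 nat) \<Rightarrow>\<^sub>0 'k"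

definition poly_ring :: "'v set \<Rightarrow> ('v, 'k::field) mpoly ring" where
  "poly_ring V =
     \<lparr>carrier = {p. \<forall>m\<in>Poly_Mapping.keys p. Poly_Mapping.keys m \<subseteq> V},
      monoid.mult = (*), monoid.one = 1, ring.zero = 0, ring.add = (+)\<rparr>"

definition mvar :: "'v \<Rightarrow> ('v, 'k::field) mpoly" where
  "mvar v = Poly_Mapping.single (Poly_Mapping.single v 1) 1"

definition mconst :: "'k::field \<Rightarrow> ('v, 'k) mpoly" where
  "mconst c = Poly_Mapping.single 0 c"

definition mon_degree :: "('v \<Rightarrow>\<^sub>0 nat) \<Rightarrow> nat" where
  "mon_degree m = (\<Sum>v\<in>Poly_Mapping.keys m. Poly_Mapping.lookup m v)"

definition homogeneous_part :: "'v set \<Rightarrow> nat \<Rightarrow> ('v, 'k::field) mpoly set" where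
  "homogeneous_part V s =
     {p \<in> carrier (poly_ring V). \<forall>m\<in>Poly_Mapping.keys p. mon_degree m = s}"

definition edge_ideal :: "'v set \<Rightarrow> 'v set set \<Rightarrow> ('v, 'k::field) mpoly set" where
  "edge_ideal V E = Idl\<^bsub>poly_ring V\<^esub> {mvar u * mvar v | u v. {u, v} \<in> E}"


section \<open>Krull dimension, Hilbert series and h-vector\<close>

definition krull_dim :: "('a, 'b) ring_scheme \<Rightarrow> enat" where
  "krull_dim R =
     Sup {enat n | n. \<exists>P. (\<forall>i\<le>n. primeideal (P i) R) \<and> (\<forall>i<n. P i \<subset> P (Suc i))}"

text \<open>The degree \<open>s\<close> part of \<open>R/I\<close>, for a proper homogeneous ideal \<open>I\<close>, is the image of the degree
  \<open>s\<close> part of \<open>R\<close>. It is a vector space over the copy of the field \<open>k\<close> inside \<open>R/I\<close>, which is the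
  image of the constant polynomials.\<close>

definition hilbert_function :: "'v set \<Rightarrow> ('v, 'k::field) mpoly set \<Rightarrow> nat \<Rightarrow> nat" where
  "hilbert_function V I s =
     (THE n. ring.dimension (poly_ring V Quot I) n
        ((\<lambda>c. I +>\<^bsub>poly_ring V\<^esub> mconst c) ` UNIV)
        ((\<lambda>p. I +>\<^bsub>poly_ring V\<^esub> p) ` homogeneous_part V s))"

definition hilbert_series :: "'v set \<Rightarrow> ('v, 'k::field) mpoly set \<Rightarrow> int fps" where
  "hilbert_series V I = Abs_fps (\<lambda>s. int (hilbert_function V I s))"

text \<open>The numerator of the Hilbert series written over \<open>(1 - t)\<^sup>d\<close> is the product of the series with
  \<open>(1 - t)\<^sup>d\<close>. The Krull dimension \<open>d\<close> is finite when \<open>V\<close> is finite.\<close>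

definition h_vector :: "'v set \<Rightarrow> ('v, 'k::field) mpoly set \<Rightarrow> nat \<Rightarrow> int" where
  "h_vector V I i =
     fps_nth (hilbert_series V I * (1 - fps_X) ^ the_enat (krull_dim (poly_ring V Quot I))) i"

end

theory Submission
  imports Defs
begin

text \<open>
Write \<open>i \<preceq> j\<close> if \<open>x\<^sub>i\<close> and \<open>y\<^sub>j\<close> are adjacent. The hypothesis on neighbours makes \<open>\<preceq>\<close> a subrelation
of \<open>\<le>\<close>, hence antisymmetric, and makes the \<open>x\<^sub>i\<close> pairwise non-adjacent; Property P at the edge
\<open>{x\<^sub>j, y\<^sub>j}\<close> makes \<open>\<preceq>\<close> transitive, and it moves an edge \<open>{y\<^sub>j, y\<^sub>k}\<close> up to \<open>{y\<^sub>l, y\<^sub>k}\<close> whenever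
\<open>j \<preceq> l\<close>. So \<open>\<preceq>\<close> is a partial order on the indices.

A basis of \<open>R/I(G)\<close> is given by the monomials whose support \<open>U\<close> is an independent set of vertices.
Attach to such a \<open>U\<close> the set \<open>S\<close> of the \<open>\<preceq>\<close>-maximal indices \<open>i\<close> with \<open>y\<^sub>i \<in> U\<close>. The edges
\<open>{x\<^sub>i, y\<^sub>i}\<close> with \<open>i \<in> S\<close> form an independent subset of \<open>M\<close>, every independent subset arises, and
the sets \<open>U\<close> that lead to \<open>S\<close> are exactly those with \<open>y(S) \<subseteq> U \<subseteq> F\<^sub>S\<close>. Here the facet \<open>F\<^sub>S\<close> consists
of the \<open>y\<^sub>i\<close> with \<open>i\<close> in the down-set of \<open>S\<close> and of the \<open>x\<^sub>i\<close> for all other \<open>i\<close>; it has \<open>t\<close> elements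
(\<open>facet_independent\<close>, \<open>generators_eq\<close>, \<open>generators_exist\<close>). The independence complex is thus
partitioned into intervals, one for each independent subset of \<open>M\<close>. The monomials with support
in the interval of \<open>S\<close> have generating function \<open>X^|S| / (1 - X)^t\<close> (\<open>interval_series_eq\<close>), so the Hilbert
series of \<open>R/I(G)\<close> is the sum of these fractions. The statement about the \<open>h\<close>-vector follows
once the Krull dimension is known to be \<open>t\<close>.

The dimension is at least \<open>t\<close> because the primes generated by the \<open>y\<^sub>j\<close> together with
\<open>x\<^sub>1, \<dots>, x\<^sub>i\<close>, for \<open>i = 0, \<dots>, t\<close>, form a chain. For the upper bound, suppose that
\<open>Q\<^sub>0 \<subset> \<dots> \<subset> Q\<^sub>r\<close> are primes containing \<open>I(G)\<close> with \<open>r = t + 1\<close>, and choose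
\<open>a\<^sub>i \<in> Q\<^sub>i\<^sub>+\<^sub>1 - Q\<^sub>i\<close>. The \<open>K^r\<close> power products of the \<open>a\<^sub>i\<close> with exponents below \<open>K\<close> have degree linear in \<open>K\<close>,
and modulo \<open>I(G)\<close> they lie in a space whose dimension grows at most like a multiple of \<open>K^t\<close>. So
they are linearly dependent for large \<open>K\<close>. But elements chosen in this way from a chain of primes
satisfy no such relation: dividing by the smallest power of \<open>a\<^sub>0\<close> and dropping the terms that still
contain \<open>a\<^sub>0\<close>, then doing the same with \<open>a\<^sub>1\<close> in the next prime, and so on,
leaves a nonzero constant in the last prime (\<open>prime_chain_no_relation\<close>).
\<close>

section \<open>The polynomial ring and monomial ideals\<close>

lemma keys_add_nat:
  fixes m n :: "'v \<Rightarrow>\<^sub>0 nat"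
  shows "Poly_Mapping.keys (m + n) = Poly_Mapping.keys m \<union> Poly_Mapping.keys n"
  by (auto simp: in_keys_iff lookup_add)

lemma mem_poly_ring:
  "p \<in> carrier (poly_ring V) \<longleftrightarrow> (\<forall>m\<in>Poly_Mapping.keys p. Poly_Mapping.keys m \<subseteq> V)"
  by (simp add: poly_ring_def)

lemma poly_ring_simps [simp]:
  "p \<otimes>\<^bsub>poly_ring V\<^esub> q = p * q" "p \<oplus>\<^bsub>poly_ring V\<^esub> q = p + q"
  "\<one>\<^bsub>poly_ring V\<^esub> = 1" "\<zero>\<^bsub>poly_ring V\<^esub> = 0"
  by (simp_all add: poly_ring_def)

lemma poly_ring_closed:
  "0 \<in> carrier (poly_ring V)" "1 \<in> carrier (poly_ring V)" "mconst c \<in> carrier (poly_ring V)"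
  "p \<in> carrier (poly_ring V) \<Longrightarrow> q \<in> carrier (poly_ring V) \<Longrightarrow> p + q \<in> carrier (poly_ring V)"
  "p \<in> carrier (poly_ring V) \<Longrightarrow> q \<in> carrier (poly_ring V) \<Longrightarrow> p * q \<in> carrier (poly_ring V)"
  "p \<in> carrier (poly_ring V) \<Longrightarrow> - p \<in> carrier (poly_ring V)"
  "Poly_Mapping.keys m \<subseteq> V \<Longrightarrow> Poly_Mapping.single m c \<in> carrier (poly_ring V)"
proof -
  show "p + q \<in> carrier (poly_ring V)"
    if "p \<in> carrier (poly_ring V)" "q \<in> carrier (poly_ring V)"
    using that keys_add[of p q] unfolding mem_poly_ring by blast
  show "p * q \<in> carrier (poly_ring V)"
    if "p \<in> carrier (poly_ring V)" "q \<in> carrier (poly_ring V)"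
    using that keys_mult[of p q] unfolding mem_poly_ring by (fastforce simp: keys_add_nat)
  show "- p \<in> carrier (poly_ring V)" if "p \<in> carrier (poly_ring V)"
    using that by (auto simp: mem_poly_ring in_keys_iff)
qed (auto simp: mem_poly_ring mconst_def)

lemma poly_ring_cring: "cring (poly_ring V :: ('v, 'k::field) mpoly ring)"
proof (rule cringI)
  show "abelian_group (poly_ring V :: ('v, 'k) mpoly ring)"
  proof (rule abelian_groupI)
    fix p :: "('v, 'k) mpoly"
    assume "p \<in> carrier (poly_ring V)"
    then show "\<exists>q\<in>carrier (poly_ring V). q \<oplus>\<^bsub>poly_ring V\<^esub> p = \<zero>\<^bsub>poly_ring V\<^esub>"
      by (intro bexI[of _ "- p"]) (auto simp: poly_ring_closed)
  qed (auto simp: poly_ring_closed algebra_simps)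
  show "Group.comm_monoid (poly_ring V :: ('v, 'k) mpoly ring)"
    by (rule Group.comm_monoidI) (auto simp: poly_ring_closed algebra_simps)
qed (auto simp: algebra_simps)

lemma poly_ring_uminus:
  assumes "p \<in> carrier (poly_ring V)"
  shows "\<ominus>\<^bsub>poly_ring V\<^esub> p = - p"
proof -
  interpret cring "poly_ring V :: ('a, 'b) mpoly ring" by (rule poly_ring_cring)
  show ?thesis using assms minus_equality[of "- p" p] by (simp add: poly_ring_closed)
qed

lemma poly_ring_minus:
  assumes "p \<in> carrier (poly_ring V)" "q \<in> carrier (poly_ring V)"
  shows "p \<ominus>\<^bsub>poly_ring V\<^esub> q = p - q"
  using assms by (simp add: a_minus_def poly_ring_uminus)

text \<open>The homogeneous components, the edge ideal and the primes of faces of the independence complex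
all have this form.\<close>

definition monomial_span :: "'v set \<Rightarrow> (('v \<Rightarrow>\<^sub>0 nat) \<Rightarrow> bool) \<Rightarrow> ('v, 'k::field) mpoly set" where
  "monomial_span V P = {p \<in> carrier (poly_ring V). \<forall>m\<in>Poly_Mapping.keys p. P m}"

lemma homogeneous_part_eq: "homogeneous_part V s = monomial_span V (\<lambda>m. mon_degree m = s)"
  by (simp add: homogeneous_part_def monomial_span_def)

text \<open>Every monomial of a product with \<open>p\<close> is a multiple of a monomial of \<open>p\<close>.\<close>

lemma monomial_span_ideal:
  assumes up: "\<And>m n. Poly_Mapping.keys m \<subseteq> V \<Longrightarrow> Poly_Mapping.keys n \<subseteq> V \<Longrightarrow> P m \<Longrightarrow> P (m + n)"
  shows "ideal (monomial_span V P :: ('v, 'k::field) mpoly set) (poly_ring V)"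
proof -
  interpret cring "poly_ring V :: ('v, 'k) mpoly ring" by (rule poly_ring_cring)
  have mult: "q * p \<in> monomial_span V P"
    if p: "p \<in> monomial_span V P" and q: "q \<in> carrier (poly_ring V)" for p q :: "('v, 'k) mpoly"
  proof -
    have "P k" if "k \<in> Poly_Mapping.keys (q * p)" for k
    proof -
      from that obtain a b where "k = b + a" "a \<in> Poly_Mapping.keys q" "b \<in> Poly_Mapping.keys p"
        using keys_mult[of q p] by (auto simp: add.commute)
      then show ?thesis using up[of b a] p q by (auto simp: monomial_span_def mem_poly_ring)
    qed
    then show ?thesis using p q by (auto simp: monomial_span_def poly_ring_closed)
  qed
  show ?thesis
  proof (rule idealI)
    show "subgroup (monomial_span V P) (add_monoid (poly_ring V :: ('v, 'k) mpoly ring))"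
    proof (rule add.subgroupI)
      show "monomial_span V P \<noteq> ({} :: ('v, 'k) mpoly set)"
        by (auto simp: monomial_span_def poly_ring_closed intro!: exI[of _ 0])
      fix p q :: "('v, 'k) mpoly"
      assume p: "p \<in> monomial_span V P"
      have m: "\<ominus>\<^bsub>poly_ring V\<^esub> p = - p"
        using p poly_ring_uminus[of p V] by (simp add: monomial_span_def)
      show "\<ominus>\<^bsub>poly_ring V\<^esub> p \<in> monomial_span V P"
        unfolding m using p by (auto simp: monomial_span_def poly_ring_closed in_keys_iff)
      assume q: "q \<in> monomial_span V P"
      show "p \<oplus>\<^bsub>poly_ring V\<^esub> q \<in> monomial_span V P"
        using p q keys_add[of p q] by (auto simp: monomial_span_def poly_ring_closed)
    qed (auto simp: monomial_span_def)
    fix p q :: "('v, 'k) mpoly"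
    assume "p \<in> monomial_span V P" "q \<in> carrier (poly_ring V)"
    then show "q \<otimes>\<^bsub>poly_ring V\<^esub> p \<in> monomial_span V P" "p \<otimes>\<^bsub>poly_ring V\<^esub> q \<in> monomial_span V P"
      using mult[of p q] by (simp_all add: mult.commute)
  qed (rule ring_axioms)
qed

lemma poly_eq_sum_single:
  fixes p :: "('v, 'k::field) mpoly"
  shows "p = (\<Sum>m\<in>Poly_Mapping.keys p. Poly_Mapping.single m (Poly_Mapping.lookup p m))"
  by (rule poly_mapping_eqI) (auto simp: lookup_sum lookup_single when_def in_keys_iff)

text \<open>The support is an independent set of vertices; these are the standard monomials of the edge ideal.\<close>

definition face_monomial :: "'v set set \<Rightarrow> ('v \<Rightarrow>\<^sub>0 nat) \<Rightarrow> bool" where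
  "face_monomial E m \<longleftrightarrow> (\<forall>u\<in>Poly_Mapping.keys m. \<forall>v\<in>Poly_Mapping.keys m. {u, v} \<notin> E)"

text \<open>In the absence of loops the ends \<open>u\<close>, \<open>v\<close> of an edge are distinct, so \<open>u * v\<close> divides a monomial as
soon as both vertices lie in its support.\<close>

lemma edge_ideal_eq:
  assumes G: "finite_graph V E" and L: "loopless E"
  shows "(edge_ideal V E :: ('v, 'k::field) mpoly set) = monomial_span V (\<lambda>m. \<not> face_monomial E m)"
    (is "_ = ?J")
proof
  interpret cring "poly_ring V :: ('v, 'k) mpoly ring" by (rule poly_ring_cring)
  let ?gens = "{mvar u * mvar v | u v. {u, v} \<in> E} :: ('v, 'k) mpoly set"
  have J: "ideal ?J (poly_ring V)"
    by (rule monomial_span_ideal) (auto simp: face_monomial_def keys_add_nat)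
  have EV: "u \<in> V" "v \<in> V" if "{u, v} \<in> E" for u v
    using G that by (fastforce simp: finite_graph_def doubleton_eq_iff)+
  have gens: "?gens \<subseteq> ?J"
    using EV by (auto simp: monomial_span_def mem_poly_ring mvar_def mult_single keys_add_nat
        face_monomial_def split: if_splits)
  then show "edge_ideal V E \<subseteq> ?J"
    unfolding edge_ideal_def by (rule genideal_minimal[OF J])
  have carr: "?gens \<subseteq> carrier (poly_ring V)"
    using gens by (auto simp: monomial_span_def)
  interpret I: ideal "edge_ideal V E :: ('v, 'k) mpoly set" "poly_ring V"
    unfolding edge_ideal_def by (rule genideal_ideal[OF carr])
  have mono: "Poly_Mapping.single m c \<in> (edge_ideal V E :: ('v, 'k) mpoly set)"
    if m: "Poly_Mapping.keys m \<subseteq> V" "\<not> face_monomial E m" for m c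
  proof -
    from m(2) obtain u v where uv: "u \<in> Poly_Mapping.keys m" "v \<in> Poly_Mapping.keys m" "{u, v} \<in> E"
      by (auto simp: face_monomial_def)
    with L have ne: "u \<noteq> v" by (auto simp: loopless_def)
    let ?e = "Poly_Mapping.single u (Suc 0) + Poly_Mapping.single v (Suc 0)"
    have eq: "m = (m - ?e) + ?e"
      using uv(1,2) ne
      by (intro poly_mapping_eqI)
        (auto simp: lookup_add lookup_minus lookup_single when_def in_keys_iff)
    have "Poly_Mapping.keys (m - ?e) \<subseteq> V"
      using m(1) by (auto simp: in_keys_iff lookup_minus)
    then have "Poly_Mapping.single (m - ?e) c \<in> carrier (poly_ring V)"
      by (rule poly_ring_closed)
    moreover have "mvar u * mvar v \<in> (edge_ideal V E :: ('v, 'k) mpoly set)"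
      using genideal_self[OF carr] uv(3) unfolding edge_ideal_def by blast
    ultimately have "Poly_Mapping.single (m - ?e) c \<otimes>\<^bsub>poly_ring V\<^esub> (mvar u * mvar v)
        \<in> (edge_ideal V E :: ('v, 'k) mpoly set)"
      by (intro I.I_l_closed)
    then show ?thesis
      by (simp add: mvar_def mult_single eq[symmetric])
  qed
  show "?J \<subseteq> edge_ideal V E"
  proof
    fix p :: "('v, 'k) mpoly" assume p: "p \<in> ?J"
    have "(\<Sum>m\<in>A. Poly_Mapping.single m (Poly_Mapping.lookup p m)) \<in> edge_ideal V E"
      if "finite A" "A \<subseteq> Poly_Mapping.keys p" for A
      using that
    proof (induction A rule: finite_induct)
      case empty
      then show ?case using I.zero_closed by simp
    next
      case (insert m A)
      have "Poly_Mapping.single m (Poly_Mapping.lookup p m) \<in> edge_ideal V E"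
        using insert.prems p by (intro mono) (auto simp: monomial_span_def mem_poly_ring)
      then show ?case using insert I.a_closed by fastforce
    qed
    from this[of "Poly_Mapping.keys p"] show "p \<in> edge_ideal V E"
      by (simp add: poly_eq_sum_single[symmetric])
  qed
qed

section \<open>Hilbert functions of monomial ideals\<close>

lemma mon_degree_eq:
  assumes "finite V" "Poly_Mapping.keys m \<subseteq> V"
  shows "mon_degree m = (\<Sum>v\<in>V. Poly_Mapping.lookup m v)"
  unfolding mon_degree_def using assms by (intro sum.mono_neutral_left) (auto simp: in_keys_iff)

lemma mon_degree_add: "mon_degree (m + n) = mon_degree m + mon_degree n"
proof -
  let ?V = "Poly_Mapping.keys m \<union> Poly_Mapping.keys n"
  have "mon_degree (m + n) = (\<Sum>v\<in>?V. Poly_Mapping.lookup (m + n) v)"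
    by (rule mon_degree_eq) (auto simp: keys_add_nat)
  also have "\<dots> = mon_degree m + mon_degree n"
    by (simp add: lookup_add sum.distrib mon_degree_eq[of ?V])
  finally show ?thesis .
qed

lemma lookup_le_mon_degree: "Poly_Mapping.lookup m v \<le> mon_degree m"
proof (cases "v \<in> Poly_Mapping.keys m")
  case True
  then show ?thesis unfolding mon_degree_def by (intro member_le_sum) auto
qed (simp add: in_keys_iff)

lemma finite_monomials:
  assumes "finite V"
  shows "finite {m :: 'v \<Rightarrow>\<^sub>0 nat. Poly_Mapping.keys m \<subseteq> V \<and> mon_degree m \<le> s}"
proof (rule finite_imageD[of Poly_Mapping.lookup])
  have fin: "finite {f. \<forall>v. (v \<in> V \<longrightarrow> f v \<in> {..s}) \<and> (v \<notin> V \<longrightarrow> f v = 0)}"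
    using assms by (intro finite_set_of_finite_funs) auto
  have "Poly_Mapping.lookup m v \<le> s" if "mon_degree m \<le> s" for m :: "'v \<Rightarrow>\<^sub>0 nat" and v
    using lookup_le_mon_degree[of m v] that by simp
  moreover have "Poly_Mapping.lookup m v = 0"
    if "Poly_Mapping.keys m \<subseteq> V" "v \<notin> V" for m :: "'v \<Rightarrow>\<^sub>0 nat" and v
  proof -
    from that have "v \<notin> Poly_Mapping.keys m" by blast
    then show ?thesis by (simp add: in_keys_iff)
  qed
  ultimately show "finite (Poly_Mapping.lookup `
      {m :: 'v \<Rightarrow>\<^sub>0 nat. Poly_Mapping.keys m \<subseteq> V \<and> mon_degree m \<le> s})"
    by (intro finite_subset[OF _ fin]) auto
qed (rule inj_onI, rule poly_mapping_eqI, simp)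

lemma constants_subfield: "subfield (range mconst) (poly_ring V :: ('v, 'k::field) mpoly ring)"
proof -
  interpret cring "poly_ring V :: ('v, 'k) mpoly ring" by (rule poly_ring_cring)
  have mult: "mconst a * mconst b = (mconst (a * b) :: ('v, 'k) mpoly)" for a b
    by (simp add: mconst_def mult_single)
  have add: "mconst a + mconst b = (mconst (a + b) :: ('v, 'k) mpoly)" for a b
    by (simp add: mconst_def single_add)
  have one: "(1 :: ('v, 'k) mpoly) = mconst 1" and zero: "(0 :: ('v, 'k) mpoly) = mconst 0"
    by (simp_all add: mconst_def)
  show ?thesis
  proof (rule subfieldI)
    show "subcring (range mconst) (poly_ring V :: ('v, 'k) mpoly ring)"
    proof (rule subcringI, rule subringI)
      show "range mconst \<subseteq> carrier (poly_ring V :: ('v, 'k) mpoly ring)"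
        by (auto simp: poly_ring_closed)
      fix p assume "p \<in> range (mconst :: _ \<Rightarrow> ('v, 'k) mpoly)"
      then obtain c where p: "p = mconst c" by auto
      have "\<ominus>\<^bsub>poly_ring V\<^esub> p = mconst (- c)"
        unfolding p by (subst poly_ring_uminus) (auto simp: poly_ring_closed mconst_def single_uminus)
      then show "\<ominus>\<^bsub>poly_ring V\<^esub> p \<in> range mconst" by simp
    qed (auto simp: mult add one mult.commute)
    show "Units (poly_ring V\<lparr>carrier := range (mconst :: _ \<Rightarrow> ('v, 'k) mpoly)\<rparr>)
        = range mconst - {\<zero>\<^bsub>poly_ring V\<^esub>}"
    proof (rule Set.set_eqI)
      fix p :: "('v, 'k) mpoly"
      have inj: "mconst a = (mconst b :: ('v, 'k) mpoly) \<longleftrightarrow> a = b" for a b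
        by (metis mconst_def lookup_single_eq)
      have "p \<in> range mconst \<and> (\<exists>q\<in>range mconst. q * p = 1 \<and> p * q = 1) \<longleftrightarrow> p \<in> range mconst - {0}"
      proof (cases "p \<in> range mconst")
        case True
        then obtain c where p: "p = mconst c" by auto
        have "(\<exists>d. d * c = 1) \<longleftrightarrow> c \<noteq> 0"
          by (auto intro: exI[of _ "inverse c"])
        then show ?thesis
          unfolding p one zero by (auto simp: mult inj mult.commute)
      qed auto
      then show "p \<in> Units (poly_ring V\<lparr>carrier := range mconst\<rparr>)
          \<longleftrightarrow> p \<in> range mconst - {\<zero>\<^bsub>poly_ring V\<^esub>}"
        by (auto simp: Units_def)
    qed
  qed
qed

text \<open>Adjoining one monomial to a spanning set has the shape of a line extension, the step by which
dimensions are built up inductively.\<close>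

lemma monomial_span_insert:
  fixes u :: "('v, 'k::field) mpoly"
  assumes "Poly_Mapping.keys m \<subseteq> V"
  shows "u \<in> monomial_span V (\<lambda>n. n \<in> insert m B) \<longleftrightarrow>
    (\<exists>c. \<exists>p\<in>monomial_span V (\<lambda>n. n \<in> B). u = mconst c * Poly_Mapping.single m 1 + p)" (is "?l \<longleftrightarrow> ?r")
proof
  assume u: ?l
  let ?p = "u - Poly_Mapping.single m (Poly_Mapping.lookup u m)"
  have "?p \<in> monomial_span V (\<lambda>n. n \<in> B)"
    using u by (auto simp: monomial_span_def mem_poly_ring in_keys_iff lookup_minus lookup_single when_def
        split: if_splits)
  then show ?r
    by (intro exI[of _ "Poly_Mapping.lookup u m"] bexI[of _ ?p]) (auto simp: mconst_def mult_single)
next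
  assume ?r
  then obtain c p where "p \<in> monomial_span V (\<lambda>n. n \<in> B)" "u = Poly_Mapping.single m c + p"
    by (auto simp: mconst_def mult_single)
  moreover have "Poly_Mapping.keys (Poly_Mapping.single m c + p) \<subseteq> insert m (Poly_Mapping.keys p)"
    using keys_add[of "Poly_Mapping.single m c" p] by (auto split: if_splits)
  ultimately show ?l using assms by (auto simp: monomial_span_def mem_poly_ring)
qed

text \<open>The classes of the monomials outside a monomial ideal form a basis of the quotient: a combination
of them that lies in the ideal has no monomials at all, and a polynomial keeps its class when its
monomials in the ideal are dropped.\<close>

lemma hilbert_function_monomial_ideal:
  assumes V: "finite V"
    and up: "\<And>m n. Poly_Mapping.keys m \<subseteq> V \<Longrightarrow> Poly_Mapping.keys n \<subseteq> V \<Longrightarrow> P m \<Longrightarrow> P (m + n)"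
    and proper: "\<not> P 0"
  shows "hilbert_function V (monomial_span V P :: ('v, 'k::field) mpoly set) s
    = card {m. Poly_Mapping.keys m \<subseteq> V \<and> \<not> P m \<and> mon_degree m = s}"
proof -
  interpret R: cring "poly_ring V :: ('v, 'k) mpoly ring" by (rule poly_ring_cring)
  define I where "I = (monomial_span V P :: ('v, 'k) mpoly set)"
  interpret I: ideal I "poly_ring V" unfolding I_def using up by (rule monomial_span_ideal)
  define h where "h p = I +>\<^bsub>poly_ring V\<^esub> p" for p
  let ?Q = "poly_ring V Quot I"
  interpret h: ring_hom_ring "poly_ring V" ?Q h
    using I.rcos_ring_hom_ring unfolding h_def[abs_def] by simp
  have h_eq: "h p = h q \<longleftrightarrow> p - q \<in> I" if "p \<in> carrier (poly_ring V)" "q \<in> carrier (poly_ring V)" for p q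
    unfolding h_def R.quotient_eq_iff_same_a_r_cos[OF I.is_ideal that, symmetric]
      poly_ring_minus[OF that] ..
  define K where "K = h ` range mconst"
  have "1 \<notin> I" unfolding I_def monomial_span_def using proper by auto
  have h0: "h 0 = \<zero>\<^bsub>?Q\<^esub>" and h1: "h 1 = \<one>\<^bsub>?Q\<^esub>"
    using h.hom_zero h.hom_one by (simp_all only: poly_ring_simps)
  have "h 1 \<noteq> h 0"
    using \<open>1 \<notin> I\<close> h_eq[of 1 0] by (simp add: poly_ring_closed)
  then have "\<one>\<^bsub>?Q\<^esub> \<noteq> \<zero>\<^bsub>?Q\<^esub>" by (simp only: h0 h1 not_False_eq_True)
  then have K: "subfield K ?Q"
    unfolding K_def by (rule h.img_is_subfield(2)[OF constants_subfield])
  let ?W = "\<lambda>B. h ` monomial_span V (\<lambda>n. n \<in> B)"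
  have dim: "h.S.dimension (card B) K (?W B)"
    if "finite B" "\<And>m. m \<in> B \<Longrightarrow> Poly_Mapping.keys m \<subseteq> V \<and> \<not> P m" for B
    using that
  proof (induction B rule: finite_induct)
    case empty
    have "monomial_span V (\<lambda>n. n \<in> {}) = ({0} :: ('v, 'k) mpoly set)"
      by (auto simp: monomial_span_def poly_ring_closed)
    then have "?W {} = {\<zero>\<^bsub>?Q\<^esub>}" by (simp only: image_insert image_empty h0)
    then show ?case by (simp only: card.empty h.S.dimension.zero_dim)
  next
    case (insert m B)
    let ?e = "Poly_Mapping.single m 1 :: ('v, 'k) mpoly"
    have m: "Poly_Mapping.keys m \<subseteq> V" "\<not> P m" using insert.prems by auto
    have e: "?e \<in> carrier (poly_ring V)" using m by (simp add: poly_ring_closed)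
    have sub: "p \<in> carrier (poly_ring V)" if "p \<in> monomial_span V (\<lambda>n. n \<in> B)" for p :: "('v, 'k) mpoly"
      using that by (simp add: monomial_span_def)
    have "h ?e \<notin> ?W B"
    proof
      assume "h ?e \<in> ?W B"
      then obtain p where p: "p \<in> monomial_span V (\<lambda>n. n \<in> B)" and "h ?e = h p" by auto
      then have "?e - p \<in> I" using h_eq[OF e sub[OF p]] by simp
      moreover have "m \<in> Poly_Mapping.keys (?e - p)"
        using p insert.hyps by (auto simp: monomial_span_def in_keys_iff lookup_minus)
      ultimately show False using m(2) unfolding I_def monomial_span_def by blast
    qed
    then have "h.S.dimension (Suc (card B)) K (h.S.line_extension K (h ?e) (?W B))"
      using insert e by (intro h.S.dimension.Suc_dim h.hom_closed insert.IH) blast+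
    moreover have "h.S.line_extension K (h ?e) (?W B) = ?W (insert m B)"
    proof (rule Set.set_eqI)
      fix w
      have step: "h (mconst c) \<otimes>\<^bsub>?Q\<^esub> h ?e \<oplus>\<^bsub>?Q\<^esub> h p = h (mconst c * ?e + p)"
        if "p \<in> monomial_span V (\<lambda>n. n \<in> B)" for c p
        using e sub[OF that] h.hom_mult[of "mconst c" ?e] h.hom_add[of "mconst c * ?e" p]
        by (simp add: poly_ring_closed)
      have "w \<in> h.S.line_extension K (h ?e) (?W B) \<longleftrightarrow>
          (\<exists>c. \<exists>p\<in>monomial_span V (\<lambda>n. n \<in> B). w = h (mconst c) \<otimes>\<^bsub>?Q\<^esub> h ?e \<oplus>\<^bsub>?Q\<^esub> h p)"
        unfolding h.S.line_extension_mem_iff K_def by blast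
      also have "\<dots> \<longleftrightarrow> (\<exists>c. \<exists>p\<in>monomial_span V (\<lambda>n. n \<in> B). w = h (mconst c * ?e + p))"
        using step by auto
      also have "\<dots> \<longleftrightarrow> w \<in> ?W (insert m B)"
        unfolding image_iff Bex_def monomial_span_insert[OF m(1)] by blast
      finally show "w \<in> h.S.line_extension K (h ?e) (?W B) \<longleftrightarrow> w \<in> ?W (insert m B)" .
    qed
    ultimately show ?case
      by (simp only: card_insert_disjoint[OF insert.hyps])
  qed
  define B where "B = {m. Poly_Mapping.keys m \<subseteq> V \<and> \<not> P m \<and> mon_degree m = s}"
  have "finite B"
    by (rule finite_subset[OF _ finite_monomials[OF V, of s]]) (auto simp: B_def)
  then have "h.S.dimension (card B) K (?W B)" by (rule dim) (auto simp: B_def)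
  moreover have "?W B = h ` homogeneous_part V s"
  proof
    show "?W B \<subseteq> h ` homogeneous_part V s"
      by (rule image_mono) (auto simp: homogeneous_part_eq monomial_span_def B_def)
    show "h ` homogeneous_part V s \<subseteq> ?W B"
    proof
      fix w assume "w \<in> h ` homogeneous_part V s"
      then obtain p where w: "w = h p" and p: "p \<in> homogeneous_part V s" by auto
      \<comment> \<open>the part of \<open>p\<close> outside the ideal\<close>
      define q where "q = (\<Sum>m\<in>Poly_Mapping.keys p \<inter> {m. \<not> P m}. Poly_Mapping.single m (Poly_Mapping.lookup p m))"
      have q: "Poly_Mapping.lookup q m = (if P m then 0 else Poly_Mapping.lookup p m)" for m
        unfolding q_def by (auto simp: lookup_sum lookup_single when_def in_keys_iff)
      have pc: "p \<in> carrier (poly_ring V)" using p by (simp add: homogeneous_part_def)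
      have qB: "q \<in> monomial_span V (\<lambda>n. n \<in> B)"
        using p by (auto simp: homogeneous_part_def monomial_span_def mem_poly_ring B_def in_keys_iff q
            split: if_splits)
      then have "q \<in> carrier (poly_ring V)" by (simp add: monomial_span_def)
      moreover have "p - q \<in> monomial_span V P"
        using pc by (auto simp: monomial_span_def mem_poly_ring in_keys_iff q lookup_minus
            split: if_splits)
      ultimately have "h p = h q" using h_eq[OF pc] unfolding I_def by blast
      then show "w \<in> ?W B" using w qB by auto
    qed
  qed
  ultimately have "h.S.dimension (card B) K (h ` homogeneous_part V s)" by simp
  then have "(THE n. h.S.dimension n K (h ` homogeneous_part V s)) = card B"
    using h.S.dimension_is_inj[OF K] by blast
  moreover have "K = (\<lambda>c. I +>\<^bsub>poly_ring V\<^esub> mconst c) ` UNIV"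
    unfolding K_def h_def image_image ..
  moreover have "h = (\<lambda>p. I +>\<^bsub>poly_ring V\<^esub> p)" by (rule ext) (rule h_def)
  ultimately show ?thesis
    by (simp only: hilbert_function_def I_def B_def)
qed

section \<open>Counting monomials with support in an interval\<close>

text \<open>The supports range over the Boolean interval between \<open>R\<close> and \<open>F\<close>.\<close>

definition interval_monomials :: "'v set \<Rightarrow> 'v set \<Rightarrow> nat \<Rightarrow> ('v \<Rightarrow>\<^sub>0 nat) set" where
  "interval_monomials R F s =
     {m. R \<subseteq> Poly_Mapping.keys m \<and> Poly_Mapping.keys m \<subseteq> F \<and> mon_degree m = s}"

definition interval_series :: "'v set \<Rightarrow> 'v set \<Rightarrow> int fps" where
  "interval_series R F = Abs_fps (\<lambda>s. int (card (interval_monomials R F s)))"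

lemma finite_interval_monomials: "finite F \<Longrightarrow> finite (interval_monomials R F s)"
  by (rule finite_subset[OF _ finite_monomials[of F s]]) (auto simp: interval_monomials_def)

lemma mon_degree_single: "mon_degree (Poly_Mapping.single v k) = k"
  by (simp add: mon_degree_def)

text \<open>Multiplication by \<open>v\<close> is a bijection onto the monomials divisible by \<open>v\<close>; it raises the degree by one.\<close>

lemma interval_series_insert_lower:
  assumes F: "finite F" and v: "v \<in> F" "v \<notin> R"
  shows "interval_series (insert v R) F = fps_X * interval_series R F"
proof (rule fps_ext)
  fix s
  let ?e = "Poly_Mapping.single v (Suc 0)"
  show "fps_nth (interval_series (insert v R) F) s = fps_nth (fps_X * interval_series R F) s"
  proof (cases s)
    case 0
    have "mon_degree m \<noteq> 0" if "insert v R \<subseteq> Poly_Mapping.keys m" for m :: "'a \<Rightarrow>\<^sub>0 nat"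
      using that lookup_le_mon_degree[of m v] by (auto simp: in_keys_iff)
    then have "interval_monomials (insert v R) F 0 = {}"
      by (auto simp: interval_monomials_def)
    then show ?thesis using 0 by (simp add: interval_series_def)
  next
    case (Suc k)
    have "bij_betw (\<lambda>m. m + ?e) (interval_monomials R F k) (interval_monomials (insert v R) F (Suc k))"
    proof (rule bij_betwI[where g = "\<lambda>m. m - ?e"])
      show "(\<lambda>m. m + ?e) \<in> interval_monomials R F k \<rightarrow> interval_monomials (insert v R) F (Suc k)"
        using v by (auto simp: interval_monomials_def keys_add_nat mon_degree_add mon_degree_single)
      show "(\<lambda>m. m - ?e) \<in> interval_monomials (insert v R) F (Suc k) \<rightarrow> interval_monomials R F k"
      proof
        fix m assume m: "m \<in> interval_monomials (insert v R) F (Suc k)"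
        have eq: "m - ?e + ?e = m"
          using m by (intro poly_mapping_eqI)
            (auto simp: interval_monomials_def lookup_add lookup_minus lookup_single when_def in_keys_iff)
        have "Poly_Mapping.keys (m - ?e) \<subseteq> Poly_Mapping.keys m"
          "Poly_Mapping.keys m \<subseteq> insert v (Poly_Mapping.keys (m - ?e))"
          using eq keys_add_nat[of "m - ?e" ?e] by auto
        moreover have "mon_degree m = Suc (mon_degree (m - ?e))"
          using eq mon_degree_add[of "m - ?e" ?e] by (simp add: mon_degree_single)
        ultimately show "m - ?e \<in> interval_monomials R F k"
          using m v by (auto simp: interval_monomials_def)
      qed
      show "m + ?e - ?e = m" for m by simp
      show "m - ?e + ?e = m" if "m \<in> interval_monomials (insert v R) F (Suc k)" for m
        using that by (intro poly_mapping_eqI)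
          (auto simp: interval_monomials_def lookup_add lookup_minus lookup_single when_def in_keys_iff)
    qed
    then have "card (interval_monomials R F k) = card (interval_monomials (insert v R) F (Suc k))"
      by (rule bij_betw_same_card)
    then show ?thesis using Suc by (simp add: interval_series_def)
  qed
qed

text \<open>A monomial in the enlarged set of variables either avoids \<open>v\<close> or is \<open>v\<close> times a monomial.\<close>

lemma interval_series_insert_upper:
  assumes F: "finite F" and v: "v \<notin> F"
  shows "interval_series {} (insert v F) * (1 - fps_X) = interval_series {} F"
proof -
  have "interval_series {} (insert v F) = interval_series {} F + interval_series {v} (insert v F)"
  proof (rule fps_ext)
    fix s
    have "interval_monomials {} (insert v F) s
        = interval_monomials {} F s \<union> interval_monomials {v} (insert v F) s"
      "interval_monomials {} F s \<inter> interval_monomials {v} (insert v F) s = {}"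
      using v by (auto simp: interval_monomials_def)
    then show "fps_nth (interval_series {} (insert v F)) s
        = fps_nth (interval_series {} F + interval_series {v} (insert v F)) s"
      using F by (simp add: interval_series_def card_Un_disjoint finite_interval_monomials)
  qed
  also have "interval_series {v} (insert v F) = fps_X * interval_series {} (insert v F)"
    using F by (intro interval_series_insert_lower) auto
  finally show ?thesis by (simp add: algebra_simps)
qed

text \<open>Dividing by the product of the variables in \<open>R\<close> leaves an arbitrary monomial in the variables \<open>F\<close>.\<close>

lemma interval_series_eq:
  assumes F: "finite F" and R: "R \<subseteq> F"
  shows "interval_series R F * (1 - fps_X) ^ card F = fps_X ^ card R"
proof -
  have "interval_series {} F * (1 - fps_X) ^ card F = 1"
    using F
  proof (induction F rule: finite_induct)
    case empty
    have "interval_monomials {} {} s = (if s = 0 then {0 :: 'a \<Rightarrow>\<^sub>0 nat} else {})" for s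
      by (auto simp: interval_monomials_def mon_degree_def)
    then show ?case by (intro fps_ext) (simp add: interval_series_def)
  next
    case (insert v F)
    have "interval_series {} (insert v F) * (1 - fps_X) ^ card (insert v F)
        = (interval_series {} (insert v F) * (1 - fps_X)) * (1 - fps_X) ^ card F"
      using insert.hyps by (simp add: mult.assoc)
    then show ?case using insert by (simp add: interval_series_insert_upper)
  qed
  moreover have "interval_series R F = fps_X ^ card R * interval_series {} F"
    using finite_subset[OF R F] R
  proof (induction R rule: finite_induct)
    case (insert v R)
    then show ?case using interval_series_insert_lower[OF F, of v R] by (simp add: mult.assoc)
  qed simp
  ultimately show ?thesis by (simp add: mult.assoc)
qed

section \<open>Krull dimension: quotients and prime ideals of faces\<close>

text \<open>Taking preimages and images under the projection is an inclusion-preserving correspondence between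
the primes of the quotient and the primes above \<open>I\<close>.\<close>

lemma krull_dim_quotient:
  assumes R: "cring R" and I: "ideal I R"
  shows "krull_dim (R Quot I) =
    Sup {enat n | n. \<exists>P. (\<forall>i\<le>n. primeideal (P i) R \<and> I \<subseteq> P i) \<and> (\<forall>i<n. P i \<subset> P (Suc i))}"
proof -
  interpret R: cring R by (rule R)
  interpret I: ideal I R by (rule I)
  define h where "h p = I +>\<^bsub>R\<^esub> p" for p
  let ?Q = "R Quot I"
  interpret h: ring_hom_ring R ?Q h
    using I.rcos_ring_hom_ring unfolding h_def[abs_def] by simp
  have h_eq: "h p = h q \<longleftrightarrow> p \<ominus>\<^bsub>R\<^esub> q \<in> I" if "p \<in> carrier R" "q \<in> carrier R" for p q
    unfolding h_def using R.quotient_eq_iff_same_a_r_cos[OF I that] ..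
  have surj: "carrier ?Q = h ` carrier R"
    unfolding h_def[abs_def] FactRing_def by (auto simp: A_RCOSETS_def')
  have Qc: "cring ?Q" by (rule I.quotient_is_cring[OF R])
  have pull: "primeideal {r \<in> carrier R. h r \<in> P} R \<and> I \<subseteq> {r \<in> carrier R. h r \<in> P}"
    if P: "primeideal P ?Q" for P
  proof
    interpret P: primeideal P ?Q by (rule P)
    show "primeideal {r \<in> carrier R. h r \<in> P} R"
      by (rule h.primeideal_vimage[OF R P])
    show "I \<subseteq> {r \<in> carrier R. h r \<in> P}"
    proof
      fix r assume r: "r \<in> I"
      then have rc: "r \<in> carrier R" by (rule I.Icarr)
      have "r \<ominus>\<^bsub>R\<^esub> \<zero>\<^bsub>R\<^esub> \<in> I"
        using r rc by (simp add: R.minus_eq)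
      then have "h r = h \<zero>\<^bsub>R\<^esub>" using h_eq[OF rc R.zero_closed] by blast
      then have "h r = \<zero>\<^bsub>?Q\<^esub>" by (simp only: h.hom_zero)
      then show "r \<in> {r \<in> carrier R. h r \<in> P}" using rc P.zero_closed by simp
    qed
  qed
  have mem: "h r \<in> h ` Q \<longleftrightarrow> r \<in> Q" if Q: "ideal Q R" "I \<subseteq> Q" and r: "r \<in> carrier R" for Q r
  proof
    interpret Q: ideal Q R by (rule Q)
    assume "h r \<in> h ` Q"
    then obtain q where q: "q \<in> Q" "h r = h q" by auto
    then have qc: "q \<in> carrier R" using Q.Icarr by blast
    then have "r \<ominus>\<^bsub>R\<^esub> q \<in> Q" using q h_eq[OF r qc] Q(2) by blast
    then have "(r \<ominus>\<^bsub>R\<^esub> q) \<oplus>\<^bsub>R\<^esub> q \<in> Q" using q by blast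
    then show "r \<in> Q" using r qc by (simp add: R.minus_eq R.a_assoc R.l_neg)
  qed auto
  have push: "primeideal (h ` Q) ?Q" if Q: "primeideal Q R" "I \<subseteq> Q" for Q
  proof -
    interpret Q: primeideal Q R by (rule Q)
    show ?thesis
    proof (rule primeidealI[OF _ Qc])
      show "ideal (h ` Q) ?Q"
        unfolding h_def[abs_def] by (rule R.ring_ideal_imp_quot_ideal[OF I Q.is_ideal])
      have "\<one>\<^bsub>R\<^esub> \<notin> Q" using Q.I_notcarr Q.one_imp_carrier by blast
      then have "h \<one>\<^bsub>R\<^esub> \<notin> h ` Q" using mem[OF Q.is_ideal Q(2)] by blast
      then show "carrier ?Q \<noteq> h ` Q" using surj by blast
      fix a b assume "a \<in> carrier ?Q" "b \<in> carrier ?Q" and ab: "a \<otimes>\<^bsub>?Q\<^esub> b \<in> h ` Q"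
      then obtain r s where rs: "r \<in> carrier R" "s \<in> carrier R" "a = h r" "b = h s"
        unfolding surj by blast
      with ab have "h (r \<otimes>\<^bsub>R\<^esub> s) \<in> h ` Q" by simp
      then have "r \<otimes>\<^bsub>R\<^esub> s \<in> Q" using mem[OF Q.is_ideal Q(2)] rs by blast
      then show "a \<in> h ` Q \<or> b \<in> h ` Q" using Q.I_prime rs by blast
    qed
  qed
  have "(\<exists>P. (\<forall>i\<le>n. primeideal (P i) ?Q) \<and> (\<forall>i<n. P i \<subset> P (Suc i))) \<longleftrightarrow>
      (\<exists>P. (\<forall>i\<le>n. primeideal (P i) R \<and> I \<subseteq> P i) \<and> (\<forall>i<n. P i \<subset> P (Suc i)))" (is "?l \<longleftrightarrow> ?r") for n
  proof
    assume ?l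
    then obtain P where P: "\<And>i. i \<le> n \<Longrightarrow> primeideal (P i) ?Q" "\<And>i. i < n \<Longrightarrow> P i \<subset> P (Suc i)" by blast
    have "{r \<in> carrier R. h r \<in> P i} \<subset> {r \<in> carrier R. h r \<in> P (Suc i)}" if i: "i < n" for i
    proof -
      interpret P: primeideal "P (Suc i)" ?Q using P i by simp
      obtain w where w: "w \<in> P (Suc i)" "w \<notin> P i" using P(2)[OF i] by blast
      then obtain r where "r \<in> carrier R" "w = h r" using P.Icarr surj by blast
      then show ?thesis using w P(2)[OF i] by blast
    qed
    then show ?r
      using P pull by (intro exI[of _ "\<lambda>i. {r \<in> carrier R. h r \<in> P i}"]) blast
  next
    assume ?r
    then obtain P where P: "\<And>i. i \<le> n \<Longrightarrow> primeideal (P i) R" "\<And>i. i \<le> n \<Longrightarrow> I \<subseteq> P i"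
      "\<And>i. i < n \<Longrightarrow> P i \<subset> P (Suc i)" by blast
    have "h ` P i \<subset> h ` P (Suc i)" if i: "i < n" for i
    proof -
      interpret P: primeideal "P i" R using P i by simp
      interpret S: primeideal "P (Suc i)" R using P i by simp
      obtain r where r: "r \<in> P (Suc i)" "r \<notin> P i" using P(3)[OF i] by blast
      have "h r \<notin> h ` P i"
        using mem[OF P.is_ideal P(2) S.Icarr[OF r(1)]] r(2) i by auto
      then show ?thesis using r P(3)[OF i] by blast
    qed
    then show ?l
      using push[OF P(1,2)] by (intro exI[of _ "\<lambda>i. h ` P i"] conjI allI impI)
  qed
  then show ?thesis unfolding krull_dim_def by simp
qed

text \<open>Powers of \<open>B\<close> as weights turn the exponents into the base-\<open>B\<close> digits of the weighted degree.\<close>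

lemma injective_weight:
  assumes "finite V"
  shows "\<exists>w :: 'v \<Rightarrow> nat. \<forall>f g. (\<forall>v\<in>V. f v < B \<and> g v < B) \<longrightarrow>
    (\<Sum>v\<in>V. f v * w v) = (\<Sum>v\<in>V. g v * w v) \<longrightarrow> (\<forall>v\<in>V. f v = g v)"
  using assms
proof (induction V rule: finite_induct)
  case (insert u V)
  then obtain w where w: "\<And>f g. (\<forall>v\<in>V. f v < B \<and> g v < B) \<Longrightarrow>
    (\<Sum>v\<in>V. f v * w v) = (\<Sum>v\<in>V. g v * w v) \<Longrightarrow> (\<forall>v\<in>V. f v = g v)"
    by blast
  define w' where "w' v = (if v = u then 1 else B * w v)" for v
  have sum: "(\<Sum>v\<in>insert u V. f v * w' v) = f u + B * (\<Sum>v\<in>V. f v * w v)" for f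
  proof -
    have "(\<Sum>v\<in>V. f v * w' v) = (\<Sum>v\<in>V. B * (f v * w v))"
      using insert.hyps by (intro sum.cong) (auto simp: w'_def)
    then show ?thesis using insert.hyps by (simp add: w'_def sum_distrib_left)
  qed
  have "\<forall>v\<in>insert u V. f v = g v"
    if lt: "\<forall>v\<in>insert u V. f v < B \<and> g v < B"
      and eq: "f u + B * (\<Sum>v\<in>V. f v * w v) = g u + B * (\<Sum>v\<in>V. g v * w v)" for f g
  proof -
    have B: "f u < B" "g u < B" using lt by auto
    have u: "f u = g u"
      using arg_cong[OF eq, of "\<lambda>n. n mod B"] B by simp
    then have "(\<Sum>v\<in>V. f v * w v) = (\<Sum>v\<in>V. g v * w v)"
      using eq B by simp
    then show ?thesis using w[of f g] lt u by blast
  qed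
  then show ?case
    unfolding sum[symmetric] by (intro exI[of _ w']) blast
qed simp

text \<open>If \<open>p\<close> and \<open>q\<close> both have monomials supported in \<open>F\<close>, the product of the heaviest such monomials cannot
cancel in \<open>p * q\<close>. A weight that separates the finitely many monomials involved takes the place of a
monomial order, and so no order on the variables has to be chosen.\<close>

lemma face_prime:
  assumes V: "finite V" and F: "F \<subseteq> V"
  shows "primeideal (monomial_span V (\<lambda>m. \<not> Poly_Mapping.keys m \<subseteq> F) :: ('v, 'k::field) mpoly set)
    (poly_ring V)" (is "primeideal ?P _")
proof (rule primeidealI[OF _ poly_ring_cring])
  show "ideal ?P (poly_ring V)"
    by (rule monomial_span_ideal) (auto simp: keys_add_nat)
  have "1 \<in> carrier (poly_ring V) - ?P"
    by (simp add: monomial_span_def poly_ring_closed)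
  then show "carrier (poly_ring V) \<noteq> ?P" by blast
  fix p q :: "('v, 'k) mpoly"
  assume p: "p \<in> carrier (poly_ring V)" and q: "q \<in> carrier (poly_ring V)"
    and pq: "p \<otimes>\<^bsub>poly_ring V\<^esub> q \<in> ?P"
  show "p \<in> ?P \<or> q \<in> ?P"
  proof (rule ccontr)
    assume "\<not> (p \<in> ?P \<or> q \<in> ?P)"
    define K where "K r = {m \<in> Poly_Mapping.keys r. Poly_Mapping.keys m \<subseteq> F}" for r :: "('v, 'k) mpoly"
    have ne: "K p \<noteq> {}" "K q \<noteq> {}"
      using \<open>\<not> (p \<in> ?P \<or> q \<in> ?P)\<close> p q by (auto simp: K_def monomial_span_def)
    have fin: "finite (K p)" "finite (K q)" by (auto simp: K_def)
    define B where "B = Suc (Max (mon_degree ` (K p \<union> K q)))"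
    have B: "Poly_Mapping.lookup m v < B" if "m \<in> K p \<union> K q" for m v
    proof -
      have "mon_degree m \<le> Max (mon_degree ` (K p \<union> K q))"
        using that fin by (intro Max_ge) auto
      then show ?thesis using lookup_le_mon_degree[of m v] unfolding B_def by linarith
    qed
    obtain w :: "'v \<Rightarrow> nat" where w: "\<And>f g. (\<forall>v\<in>F. f v < B \<and> g v < B) \<Longrightarrow>
      (\<Sum>v\<in>F. f v * w v) = (\<Sum>v\<in>F. g v * w v) \<Longrightarrow> (\<forall>v\<in>F. f v = g v)"
      using injective_weight[OF finite_subset[OF F V], of B] by blast
    define W where "W m = (\<Sum>v\<in>F. Poly_Mapping.lookup m v * w v)" for m
    have W_add: "W (m + n) = W m + W n" for m n
      by (simp add: W_def lookup_add sum.distrib distrib_right)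
    have W_inj: "m = n" if "m \<in> K p \<union> K q" "n \<in> K p \<union> K q" "W m = W n" for m n
    proof (rule poly_mapping_eqI)
      have agree: "\<forall>v\<in>F. Poly_Mapping.lookup m v = Poly_Mapping.lookup n v"
        using B[OF that(1)] B[OF that(2)] that(3) by (intro w) (simp_all add: W_def)
      fix v
      show "Poly_Mapping.lookup m v = Poly_Mapping.lookup n v"
      proof (cases "v \<in> F")
        case False
        then have "v \<notin> Poly_Mapping.keys m" "v \<notin> Poly_Mapping.keys n"
          using that by (auto simp: K_def)
        then show ?thesis by (simp add: in_keys_iff)
      qed (use agree in blast)
    qed
    have heaviest: "\<exists>m\<in>L. \<forall>k\<in>L. W k \<le> W m" if "finite L" "L \<noteq> {}" for L
    proof -
      have "Max (W ` L) \<in> W ` L" using that by (intro Max_in) auto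
      then obtain m where "m \<in> L" "W m = Max (W ` L)" by auto
      moreover have "W k \<le> Max (W ` L)" if "k \<in> L" for k
        using \<open>finite L\<close> that by (intro Max_ge) auto
      ultimately show ?thesis by metis
    qed
    obtain m where m: "m \<in> K p" "\<And>k. k \<in> K p \<Longrightarrow> W k \<le> W m"
      using heaviest[OF fin(1) ne(1)] by blast
    obtain n where n: "n \<in> K q" "\<And>k. k \<in> K q \<Longrightarrow> W k \<le> W n"
      using heaviest[OF fin(2) ne(2)] by blast
    let ?a = "Poly_Mapping.lookup p m" and ?b = "Poly_Mapping.lookup q n"
    \<comment> \<open>splitting off the heaviest terms leaves products without the monomial \<open>m + n\<close>\<close>
    define p' where "p' = p - Poly_Mapping.single m ?a"
    define q' where "q' = q - Poly_Mapping.single n ?b"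
    have keys': "Poly_Mapping.keys p' = Poly_Mapping.keys p - {m}"
      "Poly_Mapping.keys q' = Poly_Mapping.keys q - {n}"
      by (auto simp: p'_def q'_def in_keys_iff lookup_minus lookup_single when_def split: if_splits)
    have "p * q = Poly_Mapping.single (m + n) (?a * ?b) + (Poly_Mapping.single m ?a * q' + p' * q)"
      by (simp add: p'_def q'_def mult_single[symmetric] algebra_simps)
    moreover have "m + n \<notin> Poly_Mapping.keys (Poly_Mapping.single m ?a * q')"
    proof
      assume "m + n \<in> Poly_Mapping.keys (Poly_Mapping.single m ?a * q')"
      then obtain l where "m + n = m + l" "l \<in> Poly_Mapping.keys q'"
        using keys_mult[of "Poly_Mapping.single m ?a" q'] by (auto split: if_splits)
      then show False using keys' by simp
    qed
    moreover have "m + n \<notin> Poly_Mapping.keys (p' * q)"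
    proof
      assume "m + n \<in> Poly_Mapping.keys (p' * q)"
      then obtain k l where kl: "m + n = k + l" "k \<in> Poly_Mapping.keys p'" "l \<in> Poly_Mapping.keys q"
        using keys_mult[of p' q] by blast
      have "Poly_Mapping.keys (k + l) \<subseteq> F"
        using m(1) n(1) unfolding kl(1)[symmetric] by (auto simp: keys_add_nat K_def)
      then have K: "k \<in> K p" "l \<in> K q" using kl keys' by (auto simp: K_def keys_add_nat)
      have "W k + W l = W m + W n" using kl(1) W_add by metis
      then have "W k = W m" using m(2)[OF K(1)] n(2)[OF K(2)] by linarith
      then have "k = m" using W_inj K m by blast
      then show False using kl keys' by simp
    qed
    ultimately have "Poly_Mapping.lookup (p * q) (m + n) = ?a * ?b"
      by (simp add: lookup_add in_keys_iff)
    moreover have "?a \<noteq> 0" "?b \<noteq> 0" using m n by (auto simp: K_def in_keys_iff)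
    ultimately have "m + n \<in> Poly_Mapping.keys (p * q)" by (simp add: in_keys_iff)
    moreover have "Poly_Mapping.keys (m + n) \<subseteq> F" using m n by (auto simp: K_def keys_add_nat)
    ultimately show False using pq by (auto simp: monomial_span_def)
  qed
qed

section \<open>Krull dimension: the length of prime chains\<close>

text \<open>Gaussian elimination: each coordinate eliminates at most one vector, so one is left at the end.\<close>

lemma exists_linear_relation:
  fixes f :: "'a \<Rightarrow> 'b \<Rightarrow> 'k::field"
  assumes "finite B" "finite A" "card B < card A"
  shows "\<exists>c. (\<exists>a\<in>A. c a \<noteq> 0) \<and> (\<forall>b\<in>B. (\<Sum>a\<in>A. c a * f a b) = 0)"
  using assms
proof (induction B arbitrary: A f rule: finite_induct)
  case empty
  then have "A \<noteq> {}" by auto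
  then show ?case by (intro exI[of _ "\<lambda>_. 1"]) auto
next
  case (insert b B)
  show ?case
  proof (cases "\<forall>a\<in>A. f a b = 0")
    case True
    obtain c where "\<exists>a\<in>A. c a \<noteq> 0" "\<forall>b\<in>B. (\<Sum>a\<in>A. c a * f a b) = 0"
      using insert.IH[of A f] insert.prems insert.hyps by auto
    then show ?thesis using True by (intro exI[of _ c]) auto
  next
    case False
    then obtain a0 where a0: "a0 \<in> A" "f a0 b \<noteq> 0" by blast
    let ?A = "A - {a0}"
    let ?g = "\<lambda>a b'. f a b' - f a b / f a0 b * f a0 b'"
    have "card B < card ?A" using insert a0 by simp
    then obtain c where c: "\<exists>a\<in>?A. c a \<noteq> 0" "\<forall>b'\<in>B. (\<Sum>a\<in>?A. c a * ?g a b') = 0"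
      using insert.IH[of ?A ?g] insert.prems by blast
    \<comment> \<open>chosen such that the relation also holds at the eliminated coordinate \<open>b\<close>\<close>
    define c0 where "c0 = - (\<Sum>a\<in>?A. c a * f a b) / f a0 b"
    define c' where "c' = c(a0 := c0)"
    have split: "(\<Sum>a\<in>A. c' a * f a b') = c0 * f a0 b' + (\<Sum>a\<in>?A. c a * f a b')" for b'
    proof -
      have "(\<Sum>a\<in>A. c' a * f a b') = c' a0 * f a0 b' + (\<Sum>a\<in>?A. c' a * f a b')"
        by (rule sum.remove) (use insert.prems a0 in auto)
      also have "(\<Sum>a\<in>?A. c' a * f a b') = (\<Sum>a\<in>?A. c a * f a b')"
        by (rule sum.cong) (auto simp: c'_def)
      finally show ?thesis by (simp add: c'_def)
    qed
    have "(\<Sum>a\<in>A. c' a * f a b') = 0" if b': "b' \<in> insert b B" for b'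
    proof (cases "b' = b")
      case True
      then show ?thesis using a0 by (simp add: split c0_def)
    next
      case False
      have "(\<Sum>a\<in>?A. c a * ?g a b') = (\<Sum>a\<in>?A. c a * f a b') - (\<Sum>a\<in>?A. c a * f a b * (f a0 b' / f a0 b))"
        by (simp add: sum_subtractf algebra_simps)
      also have "\<dots> = (\<Sum>a\<in>A. c' a * f a b')"
        by (simp add: split c0_def sum_distrib_right[symmetric] sum_divide_distrib[symmetric])
      finally show ?thesis using c(2) False b' by auto
    qed
    moreover have "\<exists>a\<in>A. c' a \<noteq> 0" using c(1) by (auto simp: c'_def)
    ultimately show ?thesis by blast
  qed
qed

lemma poly_ring_closed_sum:
  "(\<And>i. i \<in> A \<Longrightarrow> f i \<in> carrier (poly_ring V)) \<Longrightarrow> sum f A \<in> carrier (poly_ring V)"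
  by (induction A rule: infinite_finite_induct) (auto simp: poly_ring_closed)

lemma poly_ring_closed_power: "p \<in> carrier (poly_ring V) \<Longrightarrow> p ^ k \<in> carrier (poly_ring V)"
  by (induction k) (auto simp: poly_ring_closed)

lemma poly_ring_closed_prod:
  "(\<And>i. i \<in> A \<Longrightarrow> f i \<in> carrier (poly_ring V)) \<Longrightarrow> prod f A \<in> carrier (poly_ring V)"
  by (induction A rule: infinite_finite_induct) (auto simp: poly_ring_closed)

text \<open>The closure properties of a prime ideal in terms of the operations of the type of polynomials.\<close>

lemma poly_ring_prime_ideal:
  fixes Q :: "('v, 'k::field) mpoly set"
  assumes "primeideal Q (poly_ring V)"
  shows "Q \<subseteq> carrier (poly_ring V)" and "0 \<in> Q" and "1 \<notin> Q"
    and "\<And>p q. p \<in> Q \<Longrightarrow> q \<in> Q \<Longrightarrow> p + q \<in> Q"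
    and "\<And>p q. p \<in> Q \<Longrightarrow> q \<in> Q \<Longrightarrow> p - q \<in> Q"
    and "\<And>p q. p \<in> carrier (poly_ring V) \<Longrightarrow> q \<in> Q \<Longrightarrow> p * q \<in> Q"
    and "\<And>p q. p \<in> carrier (poly_ring V) \<Longrightarrow> q \<in> carrier (poly_ring V) \<Longrightarrow> p * q \<in> Q
      \<Longrightarrow> p \<in> Q \<or> q \<in> Q"
proof -
  interpret Q: primeideal Q "poly_ring V" by (rule assms)
  show sub: "Q \<subseteq> carrier (poly_ring V)" using Q.Icarr by blast
  show "0 \<in> Q" using additive_subgroup.zero_closed[OF Q.additive_subgroup_axioms] by simp
  have "\<one>\<^bsub>poly_ring V\<^esub> \<notin> Q" using Q.one_imp_carrier Q.I_notcarr by blast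
  then show "1 \<notin> Q" by simp
  show add: "p + q \<in> Q" if "p \<in> Q" "q \<in> Q" for p q
    using additive_subgroup.a_closed[OF Q.additive_subgroup_axioms that] by simp
  show mult: "p * q \<in> Q" if "p \<in> carrier (poly_ring V)" "q \<in> Q" for p q
    using Q.I_l_closed[OF that(2,1)] by simp
  show "p - q \<in> Q" if "p \<in> Q" "q \<in> Q" for p q
  proof -
    have "(- 1) * q \<in> Q" using that by (intro mult) (auto simp: poly_ring_closed)
    then show ?thesis using add[OF that(1)] by fastforce
  qed
  show "p \<in> Q \<or> q \<in> Q" if "p \<in> carrier (poly_ring V)" "q \<in> carrier (poly_ring V)" "p * q \<in> Q" for p q
    using Q.I_prime[OF that(1,2)] that(3) by simp
qed

text \<open>Assume that the sum lies in \<open>Q j\<close>. Factor out the smallest power of \<open>a j\<close> that occurs in it; since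
\<open>a j\<close> is not in the prime \<open>Q j\<close>, the cofactor is in \<open>Q j\<close> and therefore in \<open>Q (Suc j)\<close>. In that larger prime
all terms that still contain \<open>a j\<close> can be discarded. What remains is a sum of the same kind for
\<open>Suc j\<close>, over the exponents that are minimal in position \<open>j\<close>. The condition \<open>agree\<close> records the
positions treated so far; when no position is left, one exponent function remains and the sum is a
nonzero constant.\<close>

lemma prime_chain_no_relation:
  fixes Q :: "nat \<Rightarrow> ('v, 'k::field) mpoly set" and a :: "nat \<Rightarrow> ('v, 'k) mpoly"
  assumes prime: "\<And>i. i \<le> r \<Longrightarrow> primeideal (Q i) (poly_ring V)"
    and chain: "\<And>i. i < r \<Longrightarrow> Q i \<subseteq> Q (Suc i)"
    and a: "\<And>i. i < r \<Longrightarrow> a i \<in> Q (Suc i) - Q i"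
    and c: "\<And>e. e \<in> A \<Longrightarrow> c e \<noteq> 0"
    and A: "finite A" "A \<noteq> {}" "A \<subseteq> extensional {..<r}"
    and agree: "\<And>e e' i. e \<in> A \<Longrightarrow> e' \<in> A \<Longrightarrow> i < j \<Longrightarrow> e i = (e' i :: nat)"
    and j: "j \<le> r"
  shows "(\<Sum>e\<in>A. mconst (c e) * (\<Prod>i\<in>{j..<r}. a i ^ e i)) \<notin> Q j"
  using j c A agree
proof (induction j arbitrary: A rule: inc_induct)
  case base
  obtain e where e: "e \<in> A" using base.prems by blast
  have "A = {e}"
  proof -
    have "e' = e" if "e' \<in> A" for e'
      using base.prems(4,5) e that by (intro extensionalityI[of _ "{..<r}"]) blast+
    then show ?thesis using e by blast
  qed
  moreover have "mconst (c e) \<notin> Q r"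
  proof
    assume "mconst (c e) \<in> Q r"
    then have "mconst (inverse (c e)) * mconst (c e) \<in> Q r"
      by (intro poly_ring_prime_ideal(6)[OF prime] poly_ring_closed) auto
    moreover have "mconst (inverse (c e)) * mconst (c e) = (1 :: ('v, 'k) mpoly)"
      using base.prems(1)[OF e] by (simp add: mconst_def mult_single)
    ultimately show False using poly_ring_prime_ideal(3)[OF prime[of r]] by simp
  qed
  ultimately show ?case by simp
next
  case (step j)
  note Qj = poly_ring_prime_ideal[OF prime[OF less_imp_le[OF step.hyps(2)]]]
  have "Suc j \<le> r" using step.hyps(2) by simp
  note QS = poly_ring_prime_ideal[OF prime[OF this]]
  have aj: "a j \<in> Q (Suc j)" "a j \<notin> Q j" using a[OF step.hyps(2)] by auto
  have ac: "a i \<in> carrier (poly_ring V)" if "i < r" for i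
    using a[OF that] poly_ring_prime_ideal(1)[OF prime, of "Suc i"] that by auto
  define tail where "tail e = mconst (c e) * (\<Prod>i\<in>{Suc j..<r}. a i ^ e i)" for e
  have tail: "tail e \<in> carrier (poly_ring V)" for e
    unfolding tail_def
    by (intro poly_ring_closed poly_ring_closed_prod poly_ring_closed_power ac) auto
  define \<mu> where "\<mu> = Min ((\<lambda>e. e j) ` A)"
  have le: "\<mu> \<le> e j" if "e \<in> A" for e
    using that step.prems(2) by (auto simp: \<mu>_def)
  have "\<mu> \<in> (\<lambda>e. e j) ` A"
    unfolding \<mu>_def using step.prems(2,3) by (intro Min_in) auto
  then obtain e0 where e0: "e0 \<in> A" "e0 j = \<mu>" by auto
  define A' where "A' = {e \<in> A. e j = \<mu>}"
  define g where "g = (\<Sum>e\<in>A. a j ^ (e j - \<mu>) * tail e)"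
  have gc: "g \<in> carrier (poly_ring V)"
    unfolding g_def
    by (intro poly_ring_closed_sum poly_ring_closed poly_ring_closed_power tail ac step.hyps)
  have factor: "(\<Sum>e\<in>A. mconst (c e) * (\<Prod>i\<in>{j..<r}. a i ^ e i)) = a j ^ \<mu> * g"
    unfolding g_def sum_distrib_left
  proof (rule sum.cong)
    fix e assume e: "e \<in> A"
    have "a j ^ e j = a j ^ \<mu> * a j ^ (e j - \<mu>)"
      using le[OF e] by (simp add: power_add[symmetric])
    then show "mconst (c e) * (\<Prod>i\<in>{j..<r}. a i ^ e i) = a j ^ \<mu> * (a j ^ (e j - \<mu>) * tail e)"
      unfolding tail_def using step.hyps(2) by (simp add: prod.atLeast_Suc_lessThan mult_ac)
  qed simp
  have power: "a j ^ k \<notin> Q j" for k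
  proof (induction k)
    case (Suc k)
    then show ?case
      using Qj(7)[of "a j" "a j ^ k"] aj ac[OF step.hyps(2)] poly_ring_closed_power by auto
  qed (use Qj(3) in simp)
  show ?case
  proof
    assume "(\<Sum>e\<in>A. mconst (c e) * (\<Prod>i\<in>{j..<r}. a i ^ e i)) \<in> Q j"
    then have "g \<in> Q j"
      unfolding factor using Qj(7)[OF _ gc] power poly_ring_closed_power ac[OF step.hyps(2)] by blast
    then have g: "g \<in> Q (Suc j)" using chain[OF step.hyps(2)] by blast
    have rest: "(\<Sum>e\<in>B. a j ^ (e j - \<mu>) * tail e) \<in> Q (Suc j)" if "finite B" "B \<subseteq> A - A'" for B
      using that
    proof (induction B rule: finite_induct)
      case empty
      then show ?case using QS(2) by simp
    next
      case (insert e B)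
      have "e j \<noteq> \<mu>" "\<mu> \<le> e j" using insert.prems le by (auto simp: A'_def)
      then obtain k where k: "e j - \<mu> = Suc k" by (metis Suc_diff_Suc le_neq_implies_less)
      have "a j ^ k * tail e * a j \<in> Q (Suc j)"
        by (intro QS(6) aj(1) poly_ring_closed poly_ring_closed_power tail ac step.hyps)
      then have "a j ^ (e j - \<mu>) * tail e \<in> Q (Suc j)" by (simp add: k mult_ac)
      then show ?case using insert QS(4) by simp
    qed
    have "g = (\<Sum>e\<in>A'. a j ^ (e j - \<mu>) * tail e) + (\<Sum>e\<in>A - A'. a j ^ (e j - \<mu>) * tail e)"
      unfolding g_def using step.prems(2) by (subst sum.subset_diff[of A']) (auto simp: A'_def)
    also have "(\<Sum>e\<in>A'. a j ^ (e j - \<mu>) * tail e) = (\<Sum>e\<in>A'. tail e)"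
      by (rule sum.cong) (auto simp: A'_def)
    finally have "(\<Sum>e\<in>A'. tail e) = g - (\<Sum>e\<in>A - A'. a j ^ (e j - \<mu>) * tail e)" by simp
    also have "\<dots> \<in> Q (Suc j)"
      using step.prems(2) by (intro QS(5) g rest) auto
    finally have "(\<Sum>e\<in>A'. tail e) \<in> Q (Suc j)" .
    moreover have "(\<Sum>e\<in>A'. tail e) \<notin> Q (Suc j)"
      unfolding tail_def
    proof (rule step.IH)
      show "e i = e' i" if "e \<in> A'" "e' \<in> A'" "i < Suc j" for e e' i
        using that step.prems(5)[of e e' i] by (cases "i = j") (auto simp: A'_def)
    qed (use step.prems e0 in \<open>auto simp: A'_def\<close>)
    ultimately show False by blast
  qed
qed

text \<open>A bound by a predicate needs no convention for the degree of the zero polynomial.\<close>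

definition degree_le :: "nat \<Rightarrow> ('v, 'k::field) mpoly \<Rightarrow> bool" where
  "degree_le d p \<longleftrightarrow> (\<forall>m\<in>Poly_Mapping.keys p. mon_degree m \<le> d)"

lemma degree_le_1: "degree_le 0 1"
  by (simp add: degree_le_def mon_degree_def)

lemma degree_le_mult: "degree_le d p \<Longrightarrow> degree_le e q \<Longrightarrow> degree_le (d + e) (p * q)"
  using keys_mult[of p q] by (fastforce simp: degree_le_def mon_degree_add intro: add_mono)

lemma degree_le_power: "degree_le d p \<Longrightarrow> degree_le (k * d) (p ^ k)"
  by (induction k) (auto simp: degree_le_1 intro: degree_le_mult)

lemma degree_le_prod: "finite A \<Longrightarrow> (\<And>i. i \<in> A \<Longrightarrow> degree_le (d i) (f i)) \<Longrightarrow> degree_le (sum d A) (prod f A)"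
  by (induction A rule: finite_induct) (auto simp: degree_le_1 intro: degree_le_mult)

lemma degree_le_mono: "degree_le d p \<Longrightarrow> d \<le> e \<Longrightarrow> degree_le e p"
  by (fastforce simp: degree_le_def)

lemma exists_degree_le: "\<exists>d. degree_le d p"
proof
  show "degree_le (Max (mon_degree ` Poly_Mapping.keys p)) p"
    by (auto simp: degree_le_def)
qed

lemma lookup_mconst_mult: "Poly_Mapping.lookup (mconst c * p) m = c * Poly_Mapping.lookup p m"
  by (simp add: mconst_def mult_map_scale_conv_mult[symmetric] Poly_Mapping.map.rep_eq when_def)

text \<open>The dimension of a quotient by a monomial ideal is bounded by the growth of the number of its
standard monomials: if there were a chain with \<open>t + 1\<close> steps, elements chosen from successive
differences would have more power products than there are standard monomials in the degrees that
these products reach, hence a linear relation modulo the ideal.\<close>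

lemma prime_chain_length:
  fixes Q :: "nat \<Rightarrow> ('v, 'k::field) mpoly set"
  assumes V: "finite V"
    and growth: "\<And>N. card {m. Poly_Mapping.keys m \<subseteq> V \<and> \<not> P m \<and> mon_degree m \<le> N} \<le> (C * Suc N) ^ t"
    and prime: "\<And>i. i \<le> n \<Longrightarrow> primeideal (Q i) (poly_ring V)"
    and sup: "monomial_span V P \<subseteq> Q 0"
    and chain: "\<And>i. i < n \<Longrightarrow> Q i \<subset> Q (Suc i)"
  shows "n \<le> t"
proof (rule ccontr)
  assume "\<not> n \<le> t"
  define r where "r = Suc t"
  have rn: "r \<le> n" using \<open>\<not> n \<le> t\<close> by (simp add: r_def)
  have "\<forall>i. \<exists>p. i < r \<longrightarrow> p \<in> Q (Suc i) - Q i"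
    using chain rn by (meson DiffI less_le_trans psubsetE subsetI)
  then obtain a where a: "\<And>i. i < r \<Longrightarrow> a i \<in> Q (Suc i) - Q i" by metis
  have ac: "a i \<in> carrier (poly_ring V)" if "i < r" for i
    using a[OF that] poly_ring_prime_ideal(1)[OF prime, of "Suc i"] that rn by auto
  have "\<forall>i. \<exists>e. degree_le e (a i)" using exists_degree_le by blast
  then obtain d0 where d0: "\<And>i. degree_le (d0 i) (a i)" by metis
  define d where "d = (\<Sum>i<r. d0 i)"
  have d: "degree_le d (a i)" if "i < r" for i
    unfolding d_def using that by (intro degree_le_mono[OF d0[of i]] member_le_sum) auto
  define L where "L = C * Suc (r * d)"
  \<comment> \<open>large enough that \<open>L^t * K^t < K * K^t = K^r\<close>\<close>
  define K where "K = Suc (L ^ t)"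
  \<comment> \<open>bounds the degree of a power product with exponents below \<open>K\<close>\<close>
  define N where "N = r * (K * d)"
  define A where "A = PiE {..<r} (\<lambda>_. {..<K})"
  define B where "B = {m. Poly_Mapping.keys m \<subseteq> V \<and> \<not> P m \<and> mon_degree m \<le> N}"
  define v where "v e = (\<Prod>i<r. a i ^ e i)" for e :: "nat \<Rightarrow> nat"
  have finA: "finite A" by (auto simp: A_def intro: finite_PiE)
  have finB: "finite B"
    by (rule finite_subset[OF _ finite_monomials[OF V, of N]]) (auto simp: B_def)
  have "card B \<le> (C * Suc N) ^ t" unfolding B_def by (rule growth)
  also have "\<dots> \<le> (L * K) ^ t"
  proof (rule power_mono)
    have "C * Suc N \<le> C * (Suc (r * d) * K)"
      by (intro mult_le_mono2) (simp add: N_def K_def algebra_simps)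
    then show "C * Suc N \<le> L * K" by (simp only: L_def mult.assoc)
  qed simp
  also have "\<dots> = L ^ t * K ^ t" by (rule power_mult_distrib)
  also have "\<dots> < K * K ^ t"
    by (rule mult_less_le_imp_less) (simp_all add: K_def)
  also have "\<dots> = card A" by (simp add: A_def r_def card_PiE)
  finally have "card B < card A" .
  then obtain c where c: "\<exists>e\<in>A. c e \<noteq> 0" "\<forall>m\<in>B. (\<Sum>e\<in>A. c e * Poly_Mapping.lookup (v e) m) = 0"
    using exists_linear_relation[OF finB finA, of "\<lambda>e. Poly_Mapping.lookup (v e)"] by blast
  define A' where "A' = {e \<in> A. c e \<noteq> 0}"
  define p where "p = (\<Sum>e\<in>A'. mconst (c e) * v e)"
  have p_lookup: "Poly_Mapping.lookup p m = (\<Sum>e\<in>A. c e * Poly_Mapping.lookup (v e) m)" for m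
    unfolding p_def lookup_sum lookup_mconst_mult using finA
    by (intro sum.mono_neutral_left) (auto simp: A'_def)
  have vc: "v e \<in> carrier (poly_ring V)" for e
    unfolding v_def by (intro poly_ring_closed_prod poly_ring_closed_power ac) auto
  have vd: "degree_le N (v e)" if "e \<in> A" for e
  proof -
    have "degree_le (\<Sum>i<r. e i * d) (v e)"
      unfolding v_def by (intro degree_le_prod degree_le_power d) auto
    moreover have "(\<Sum>i<r. e i * d) \<le> (\<Sum>i<r. K * d)"
      using that by (intro sum_mono mult_le_mono1) (auto simp: A_def PiE_def Pi_def intro: less_imp_le)
    ultimately show ?thesis by (simp add: N_def degree_le_mono)
  qed
  have pc: "p \<in> carrier (poly_ring V)"
    unfolding p_def by (intro poly_ring_closed_sum poly_ring_closed vc)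
  have "P m" if m: "m \<in> Poly_Mapping.keys p" for m
  proof (rule ccontr)
    assume "\<not> P m"
    have nz: "(\<Sum>e\<in>A. c e * Poly_Mapping.lookup (v e) m) \<noteq> 0"
      using m by (simp add: in_keys_iff p_lookup)
    then obtain e where "e \<in> A" "m \<in> Poly_Mapping.keys (v e)"
      by (metis (no_types, lifting) in_keys_iff mult_zero_right sum.neutral)
    then have "mon_degree m \<le> N" using vd by (auto simp: degree_le_def)
    then have "m \<in> B" using \<open>\<not> P m\<close> m pc by (auto simp: B_def mem_poly_ring)
    then show False using c(2) nz by blast
  qed
  then have "p \<in> monomial_span V P" using pc by (simp add: monomial_span_def)
  then have "p \<in> Q 0" using sup by blast
  moreover have "(\<Sum>e\<in>A'. mconst (c e) * (\<Prod>i\<in>{0..<r}. a i ^ e i)) \<notin> Q 0"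
  proof (rule prime_chain_no_relation[where V = V])
    show "primeideal (Q i) (poly_ring V)" if "i \<le> r" for i using prime that rn by simp
    show "Q i \<subseteq> Q (Suc i)" if "i < r" for i using chain[of i] that rn by auto
    show "A' \<subseteq> extensional {..<r}" by (auto simp: A'_def A_def PiE_def)
    show "A' \<noteq> {}" using c(1) by (auto simp: A'_def)
    show "finite A'" using finA by (simp add: A'_def)
  qed (use a in \<open>auto simp: A'_def\<close>)
  ultimately show False by (simp add: p_def v_def atLeast0LessThan)
qed

section \<open>The partial order of an ordered perfect matching\<close>

text \<open>The hypotheses on \<open>M\<close> in terms of indices. The assumption \<open>exchange\<close> is Property P, where
\<open>{a, b} \<in> E\<close> already gives \<open>a \<noteq> b\<close> by \<open>loops\<close>; \<open>later\<close> is the condition on the neighbours of \<open>x i\<close>.\<close>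

locale ordered_perfect_matching =
  fixes V :: "'v set" and E :: "'v set set" and x y :: "nat \<Rightarrow> 'v" and t :: nat
  assumes graph: "finite_graph V E" and loops: "loopless E"
    and V_eq: "V = x ` {1..t} \<union> y ` {1..t}"
    and x_inj: "inj_on x {1..t}" and y_inj: "inj_on y {1..t}"
    and xy_disjoint: "x ` {1..t} \<inter> y ` {1..t} = {}"
    and matched: "i \<in> {1..t} \<Longrightarrow> {x i, y i} \<in> E"
    and exchange: "i \<in> {1..t} \<Longrightarrow> a \<in> V \<Longrightarrow> b \<in> V \<Longrightarrow> {a, x i} \<in> E \<Longrightarrow> {y i, b} \<in> E \<Longrightarrow> {a, b} \<in> E"
    and later: "i \<in> {1..t} \<Longrightarrow> j \<in> {1..t} \<Longrightarrow> j < i \<Longrightarrow> {x i, x j} \<notin> E \<and> {x i, y j} \<notin> E"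
begin

lemma no_loop: "{v} \<notin> E"
  using loops by (simp add: loopless_def)

text \<open>For \<open>i \<noteq> j\<close> the pairs \<open>{x i, y j}\<close> and \<open>{x j, y i}\<close> are both excluded, and the \<open>x i\<close> are never adjacent. So
these are the index sets of the independent subsets of the matching.\<close>

definition independent_indices :: "nat set set" where
  "independent_indices =
     {S. S \<subseteq> {1..t} \<and> (\<forall>i\<in>S. \<forall>j\<in>S. i \<noteq> j \<longrightarrow> {x i, y j} \<notin> E \<and> {y i, y j} \<notin> E)}"

text \<open>The down-set generated by \<open>S\<close> in the order in which \<open>i\<close> precedes \<open>j\<close> if \<open>{x i, y j} \<in> E\<close>.\<close>

definition below :: "nat set \<Rightarrow> nat set" where
  "below S = {i \<in> {1..t}. \<exists>j\<in>S. {x i, y j} \<in> E}"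

definition facet :: "nat set \<Rightarrow> 'v set" where
  "facet S = y ` below S \<union> x ` ({1..t} - below S)"

lemma x_independent: "i \<in> {1..t} \<Longrightarrow> j \<in> {1..t} \<Longrightarrow> {x i, x j} \<notin> E"
proof (cases i j rule: linorder_cases)
  case less
  then show "i \<in> {1..t} \<Longrightarrow> j \<in> {1..t} \<Longrightarrow> {x i, x j} \<notin> E"
    using later[of j i] by (simp add: insert_commute)
qed (use later no_loop in auto)

lemma order_le: "i \<in> {1..t} \<Longrightarrow> j \<in> {1..t} \<Longrightarrow> {x i, y j} \<in> E \<Longrightarrow> i \<le> j"
  using later[of i j] by (meson not_le)

lemma order_trans_edge:
  assumes "i \<in> {1..t}" "j \<in> {1..t}" "k \<in> {1..t}" "{x i, y j} \<in> E" "{x j, y k} \<in> E"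
  shows "{x i, y k} \<in> E"
  using exchange[of j "y k" "x i"] assms V_eq by (auto simp: insert_commute)

text \<open>Edges between the \<open>y i\<close> propagate upwards in the order; so a down-set contains such an edge only if
one joins its maximal elements.\<close>

lemma y_edge_mono:
  assumes "j \<in> {1..t}" "k \<in> {1..t}" "l \<in> {1..t}" "{y j, y k} \<in> E" "{x j, y l} \<in> E"
  shows "{y l, y k} \<in> E"
  using exchange[of j "y l" "y k"] assms V_eq by (auto simp: insert_commute)

lemma below_superset: "S \<subseteq> {1..t} \<Longrightarrow> S \<subseteq> below S"
  using matched unfolding below_def by blast

lemma card_facet: "card (facet S) = t"
proof -
  have sub: "below S \<subseteq> {1..t}" by (auto simp: below_def)
  have "y ` below S \<inter> x ` ({1..t} - below S) = {}" using xy_disjoint sub by blast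
  then have "card (facet S) = card (y ` below S) + card (x ` ({1..t} - below S))"
    unfolding facet_def using finite_subset[OF sub] by (intro card_Un_disjoint) auto
  also have "\<dots> = card (below S) + card ({1..t} - below S)"
    using sub by (simp add: card_image inj_on_subset[OF x_inj] inj_on_subset[OF y_inj])
  also have "\<dots> = t"
    using sub card_mono[OF _ sub] by (simp add: card_Diff_subset finite_subset[OF sub])
  finally show ?thesis .
qed

text \<open>An edge from \<open>x i\<close> to \<open>y j\<close> with \<open>j\<close> in the down-set would put \<open>i\<close> there too. An edge between two \<open>y\<close>-vertices of the
down-set moves up to an edge between generators of it, or to a loop.\<close>

lemma facet_independent:
  assumes S: "S \<in> independent_indices" and u: "u \<in> facet S" and v: "v \<in> facet S"
  shows "{u, v} \<notin> E"
proof
  assume e: "{u, v} \<in> E"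
  have ST: "S \<subseteq> {1..t}" using S by (simp add: independent_indices_def)
  have xy: False if "i \<in> {1..t} - below S" "j \<in> below S" "{x i, y j} \<in> E" for i j
  proof -
    from that(2) obtain k where "j \<in> {1..t}" "k \<in> S" "{x j, y k} \<in> E" by (auto simp: below_def)
    then have "{x i, y k} \<in> E" using order_trans_edge[of i j k] that ST by auto
    then show False using that(1) \<open>k \<in> S\<close> by (auto simp: below_def)
  qed
  have yy: False if "i \<in> below S" "j \<in> below S" "{y i, y j} \<in> E" for i j
  proof -
    from that obtain k l where kl: "i \<in> {1..t}" "k \<in> S" "{x i, y k} \<in> E" "j \<in> {1..t}" "l \<in> S" "{x j, y l} \<in> E"
      by (auto simp: below_def)
    then have klT: "k \<in> {1..t}" "l \<in> {1..t}" using ST by auto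
    then have "{y k, y j} \<in> E" using y_edge_mono[of i j k] that(3) kl by blast
    then have "{y l, y k} \<in> E"
      using y_edge_mono[of j k l] kl klT by (simp add: insert_commute)
    then show False
      using S kl no_loop by (cases "l = k") (auto simp: independent_indices_def)
  qed
  from u v show False unfolding facet_def
  proof (elim UnE imageE)
    fix i j assume "u = y i" "i \<in> below S" "v = y j" "j \<in> below S"
    then show False using yy e by blast
  next
    fix i j assume "u = y i" "i \<in> below S" "v = x j" "j \<in> {1..t} - below S"
    then show False using xy[of j i] e by (simp add: insert_commute)
  next
    fix i j assume "u = x i" "i \<in> {1..t} - below S" "v = y j" "j \<in> below S"
    then show False using xy[of i j] e by simp
  next
    fix i j assume "u = x i" "i \<in> {1..t} - below S" "v = x j" "j \<in> {1..t} - below S"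
    then show False using x_independent[of i j] e by simp
  qed
qed

lemma y_mem_facet: "i \<in> {1..t} \<Longrightarrow> y i \<in> facet S \<longleftrightarrow> i \<in> below S"
proof -
  assume i: "i \<in> {1..t}"
  have "y i \<in> y ` below S \<longleftrightarrow> i \<in> below S"
    using i by (intro inj_on_image_mem_iff[OF y_inj]) (auto simp: below_def)
  moreover have "y i \<notin> x ` ({1..t} - below S)" using xy_disjoint i by blast
  ultimately show ?thesis by (simp add: facet_def)
qed

text \<open>The generators \<open>S\<close> can be read off from any \<open>U\<close> in the interval, as the maximal indices \<open>i\<close> with \<open>y i \<in> U\<close>.
Hence the intervals for different \<open>S\<close> are disjoint.\<close>

lemma generators_eq:
  assumes S: "S \<in> independent_indices" and lower: "y ` S \<subseteq> U" and upper: "U \<subseteq> facet S"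
  shows "S = {i \<in> {1..t}. y i \<in> U \<and> (\<forall>j\<in>{1..t}. y j \<in> U \<longrightarrow> {x i, y j} \<in> E \<longrightarrow> i = j)}"
    (is "_ = ?max")
proof
  have ST: "S \<subseteq> {1..t}" and anti: "\<And>i j. i \<in> S \<Longrightarrow> j \<in> S \<Longrightarrow> {x i, y j} \<in> E \<Longrightarrow> i = j"
    using S by (auto simp: independent_indices_def)
  have above: "\<exists>k\<in>S. {x j, y k} \<in> E" if "j \<in> {1..t}" "y j \<in> U" for j
    using that upper y_mem_facet[of j S] by (auto simp: below_def)
  show "S \<subseteq> ?max"
  proof
    fix i assume i: "i \<in> S"
    have "i = j" if j: "j \<in> {1..t}" "y j \<in> U" "{x i, y j} \<in> E" for j
    proof -
      obtain k where k: "k \<in> S" "{x j, y k} \<in> E" using above j by blast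
      then have "{x i, y k} \<in> E" using order_trans_edge[of i j k] i j ST by blast
      then have "i = k" using anti i k by blast
      moreover have "i \<le> j" "j \<le> k" using order_le i j k ST by blast+
      ultimately show ?thesis by simp
    qed
    then show "i \<in> ?max" using i lower ST by auto
  qed
  show "?max \<subseteq> S"
  proof
    fix i assume i: "i \<in> ?max"
    then obtain k where "k \<in> S" "{x i, y k} \<in> E" using above by blast
    then have "i = k" using i lower ST by auto
    then show "i \<in> S" using \<open>k \<in> S\<close> by simp
  qed
qed

text \<open>The maximal indices \<open>i\<close> with \<open>y i \<in> U\<close> work. Their down-set contains all indices of this kind, and no \<open>i\<close>
with \<open>x i \<in> U\<close>, since such an \<open>x i\<close> would be adjacent to some \<open>y j \<in> U\<close>.\<close>

lemma generators_exist:
  assumes UV: "U \<subseteq> V" and ind: "\<And>u v. u \<in> U \<Longrightarrow> v \<in> U \<Longrightarrow> {u, v} \<notin> E"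
  shows "\<exists>S\<in>independent_indices. y ` S \<subseteq> U \<and> U \<subseteq> facet S"
proof -
  define A where "A = {i \<in> {1..t}. y i \<in> U}"
  define S where "S = {i \<in> A. \<forall>j\<in>A. {x i, y j} \<in> E \<longrightarrow> i = j}"
  have SA: "S \<subseteq> A" and AT: "A \<subseteq> {1..t}" by (auto simp: S_def A_def)
  have "S \<in> independent_indices"
    using SA AT ind by (auto simp: independent_indices_def S_def A_def)
  moreover have "y ` S \<subseteq> U" using SA by (auto simp: A_def)
  moreover have "U \<subseteq> facet S"
  proof
    fix u assume u: "u \<in> U"
    then have "u \<in> x ` {1..t} \<or> u \<in> y ` {1..t}" using UV V_eq by blast
    then consider i where "i \<in> {1..t}" "u = x i" | i where "i \<in> A" "u = y i"
      using u unfolding A_def by blast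
    then show "u \<in> facet S"
    proof cases
      case 1
      have "i \<notin> below S"
      proof
        assume "i \<in> below S"
        then obtain j where "j \<in> S" "{x i, y j} \<in> E" by (auto simp: below_def)
        then show False using ind[of "x i" "y j"] u 1 SA by (auto simp: A_def)
      qed
      then show ?thesis using 1 by (auto simp: facet_def)
    next
      case 2
      let ?B = "{j \<in> A. {x i, y j} \<in> E}"
      have fin: "finite ?B" using finite_subset[OF AT] by simp
      have "i \<in> ?B" using 2 AT matched by auto
      then have ne: "?B \<noteq> {}" by blast
      \<comment> \<open>the order is contained in \<open>\<le>\<close>, so the largest index above \<open>i\<close> is maximal in the order\<close>
      define j where "j = Max ?B"
      have j: "j \<in> A" "{x i, y j} \<in> E" using Max_in[OF fin ne] by (auto simp: j_def)
      have "j = k" if k: "k \<in> A" "{x j, y k} \<in> E" for k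
      proof -
        have "{x i, y k} \<in> E" using order_trans_edge[of i j k] j k 2 AT by blast
        then have "k \<le> j" using fin k unfolding j_def by (intro Max_ge) auto
        moreover have "j \<le> k" using order_le j k AT by blast
        ultimately show ?thesis by simp
      qed
      then have "j \<in> S" using j by (auto simp: S_def)
      then have "i \<in> below S" using j 2 AT by (auto simp: below_def)
      then show ?thesis using 2 by (auto simp: facet_def)
    qed
  qed
  ultimately show ?thesis by blast
qed

end

section \<open>The h-vector of the edge ideal\<close>

context ordered_perfect_matching
begin

lemma finite_V: "finite V"
  using graph by (simp add: finite_graph_def)

lemma x_neq_y: "i \<in> {1..t} \<Longrightarrow> j \<in> {1..t} \<Longrightarrow> x i \<noteq> y j"
  using xy_disjoint by blast

lemma finite_facet: "finite (facet S)"
  by (auto simp: facet_def below_def)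

lemma y_image_subset_facet: "S \<subseteq> {1..t} \<Longrightarrow> y ` S \<subseteq> facet S"
  using below_superset by (auto simp: facet_def)

lemma facet_subset: "facet S \<subseteq> V"
  using V_eq by (auto simp: facet_def below_def)

lemma finite_independent_indices: "finite independent_indices"
  by (rule finite_subset[of _ "Pow {1..t}"]) (auto simp: independent_indices_def)

lemma face_monomials_partition:
  "{m. Poly_Mapping.keys m \<subseteq> V \<and> face_monomial E m \<and> mon_degree m = s}
    = (\<Union>S\<in>independent_indices. interval_monomials (y ` S) (facet S) s)"
proof (intro subset_antisym subsetI)
  fix m assume m: "m \<in> {m. Poly_Mapping.keys m \<subseteq> V \<and> face_monomial E m \<and> mon_degree m = s}"
  then obtain S where "S \<in> independent_indices" "y ` S \<subseteq> Poly_Mapping.keys m" "Poly_Mapping.keys m \<subseteq> facet S"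
    using generators_exist[of "Poly_Mapping.keys m"] by (auto simp: face_monomial_def)
  then show "m \<in> (\<Union>S\<in>independent_indices. interval_monomials (y ` S) (facet S) s)"
    using m by (auto simp: interval_monomials_def)
next
  fix m assume "m \<in> (\<Union>S\<in>independent_indices. interval_monomials (y ` S) (facet S) s)"
  then obtain S where S: "S \<in> independent_indices" "Poly_Mapping.keys m \<subseteq> facet S" "mon_degree m = s"
    by (auto simp: interval_monomials_def)
  then have "face_monomial E m"
    using facet_independent unfolding face_monomial_def by blast
  then show "m \<in> {m. Poly_Mapping.keys m \<subseteq> V \<and> face_monomial E m \<and> mon_degree m = s}"
    using S facet_subset by auto
qed

lemma card_face_monomials:
  "card {m. Poly_Mapping.keys m \<subseteq> V \<and> face_monomial E m \<and> mon_degree m = s}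
    = (\<Sum>S\<in>independent_indices. card (interval_monomials (y ` S) (facet S) s))"
  unfolding face_monomials_partition
proof (rule card_UN_disjoint[OF finite_independent_indices])
  show "\<forall>S\<in>independent_indices. finite (interval_monomials (y ` S) (facet S) s)"
    by (simp add: finite_interval_monomials finite_facet)
  have "S = S'" if "S \<in> independent_indices" "S' \<in> independent_indices"
    "m \<in> interval_monomials (y ` S) (facet S) s" "m \<in> interval_monomials (y ` S') (facet S') s" for S S' m
    using that generators_eq[of S "Poly_Mapping.keys m"] generators_eq[of S' "Poly_Mapping.keys m"]
    by (simp add: interval_monomials_def)
  then show "\<forall>S\<in>independent_indices. \<forall>S'\<in>independent_indices. S \<noteq> S' \<longrightarrow>
      interval_monomials (y ` S) (facet S) s \<inter> interval_monomials (y ` S') (facet S') s = {}"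
    by blast
qed

lemma edge_ideal_monomial_span:
  "(edge_ideal V E :: ('v, 'k::field) mpoly set) = monomial_span V (\<lambda>m. \<not> face_monomial E m)"
  by (rule edge_ideal_eq[OF graph loops])

lemma hilbert_series_edge_ideal:
  "hilbert_series V (edge_ideal V E :: ('v, 'k::field) mpoly set) * (1 - fps_X) ^ t
    = (\<Sum>S\<in>independent_indices. fps_X ^ card S)"
proof -
  have "hilbert_function V (edge_ideal V E :: ('v, 'k) mpoly set) s
      = card {m. Poly_Mapping.keys m \<subseteq> V \<and> face_monomial E m \<and> mon_degree m = s}" for s
    unfolding edge_ideal_monomial_span
    by (subst hilbert_function_monomial_ideal[OF finite_V]) (auto simp: face_monomial_def keys_add_nat)
  then have "hilbert_series V (edge_ideal V E :: ('v, 'k) mpoly set)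
      = (\<Sum>S\<in>independent_indices. interval_series (y ` S) (facet S))"
    by (intro fps_ext) (simp add: hilbert_series_def card_face_monomials interval_series_def fps_sum_nth)
  moreover have "interval_series (y ` S) (facet S) * (1 - fps_X) ^ t = fps_X ^ card S"
    if "S \<in> independent_indices" for S
  proof -
    have S: "S \<subseteq> {1..t}" using that by (simp add: independent_indices_def)
    then have "card (y ` S) = card S" by (intro card_image inj_on_subset[OF y_inj])
    then show ?thesis
      using interval_series_eq[OF finite_facet y_image_subset_facet[OF S]] by (simp add: card_facet)
  qed
  ultimately show ?thesis by (simp add: sum_distrib_right)
qed

text \<open>A face monomial involves at most one of the two variables of each matching edge. On each edge it is therefore
determined by one exponent and the choice of an end.\<close>

lemma card_face_monomials_le:
  "card {m. Poly_Mapping.keys m \<subseteq> V \<and> face_monomial E m \<and> mon_degree m \<le> N} \<le> (2 * Suc N) ^ t"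
proof -
  let ?A = "{m. Poly_Mapping.keys m \<subseteq> V \<and> face_monomial E m \<and> mon_degree m \<le> N}"
  let ?D = "{..N} \<times> {0} \<union> {0} \<times> {..N}"
  define f where "f m = (\<lambda>i\<in>{1..t}. (Poly_Mapping.lookup m (x i), Poly_Mapping.lookup m (y i)))"
    for m :: "'v \<Rightarrow>\<^sub>0 nat"
  have "inj_on f ?A"
  proof (rule inj_onI, rule poly_mapping_eqI)
    fix m m' v assume m: "m \<in> ?A" "m' \<in> ?A" and eq: "f m = f m'"
    have eq: "Poly_Mapping.lookup m (x i) = Poly_Mapping.lookup m' (x i)"
      "Poly_Mapping.lookup m (y i) = Poly_Mapping.lookup m' (y i)" if "i \<in> {1..t}" for i
      using fun_cong[OF eq, of i] that by (simp_all add: f_def)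
    show "Poly_Mapping.lookup m v = Poly_Mapping.lookup m' v"
    proof (cases "v \<in> V")
      case True
      then show ?thesis using eq V_eq by blast
    next
      case False
      then have "v \<notin> Poly_Mapping.keys m" "v \<notin> Poly_Mapping.keys m'" using m by auto
      then show ?thesis by (simp add: in_keys_iff)
    qed
  qed
  moreover have "f ` ?A \<subseteq> PiE {1..t} (\<lambda>_. ?D)"
  proof (intro image_subsetI PiE_I)
    fix m i assume m: "m \<in> ?A" and i: "i \<in> {1..t}"
    have "\<not> (x i \<in> Poly_Mapping.keys m \<and> y i \<in> Poly_Mapping.keys m)"
      using m matched[OF i] by (auto simp: face_monomial_def)
    then have "Poly_Mapping.lookup m (x i) = 0 \<or> Poly_Mapping.lookup m (y i) = 0"
      by (simp add: in_keys_iff)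
    moreover have "Poly_Mapping.lookup m w \<le> N" for w
      using lookup_le_mon_degree[of m w] m by simp
    ultimately show "f m i \<in> ?D" using i by (auto simp: f_def)
  qed (auto simp: f_def)
  ultimately have "card ?A \<le> card (PiE {1..t} (\<lambda>_. ?D))"
    by (intro card_inj_on_le[of f] finite_PiE) auto
  also have "\<dots> = card ?D ^ t" by (simp add: card_PiE)
  also have "\<dots> \<le> (2 * Suc N) ^ t"
  proof (rule power_mono)
    have "card ?D \<le> card ({..N} \<times> {0::nat}) + card ({0::nat} \<times> {..N})" by (rule card_Un_le)
    then show "card ?D \<le> 2 * Suc N" by (simp add: card_cartesian_product)
  qed simp
  finally show ?thesis .
qed

text \<open>The chain for the lower bound consists of the primes of the faces \<open>{x (i + 1), \<dots>, x t}\<close>.\<close>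

lemma krull_dim_edge_ideal:
  "krull_dim (poly_ring V Quot (edge_ideal V E :: ('v, 'k::field) mpoly set)) = enat t"
proof -
  let ?I = "edge_ideal V E :: ('v, 'k) mpoly set"
  let ?chains = "{enat n | n. \<exists>Q. (\<forall>i\<le>n. primeideal (Q i) (poly_ring V) \<and> ?I \<subseteq> Q i)
    \<and> (\<forall>i<n. Q i \<subset> Q (Suc i))}"
  have I: "ideal ?I (poly_ring V)"
    unfolding edge_ideal_monomial_span
    by (rule monomial_span_ideal) (auto simp: face_monomial_def keys_add_nat)
  have "enat t \<in> ?chains"
  proof -
    define Q where "Q i = (monomial_span V (\<lambda>m. \<not> Poly_Mapping.keys m \<subseteq> x ` {i<..t}) :: ('v, 'k) mpoly set)" for i
    have "primeideal (Q i) (poly_ring V)" for i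
      unfolding Q_def using V_eq by (intro face_prime finite_V) auto
    moreover have "?I \<subseteq> Q i" for i
    proof -
      have "face_monomial E m" if m: "Poly_Mapping.keys m \<subseteq> x ` {i<..t}" for m
        unfolding face_monomial_def
      proof (intro ballI)
        fix u v assume "u \<in> Poly_Mapping.keys m" "v \<in> Poly_Mapping.keys m"
        then have "u \<in> x ` {i<..t}" "v \<in> x ` {i<..t}" using m by blast+
        then obtain j k where "u = x j" "j \<in> {i<..t}" "v = x k" "k \<in> {i<..t}" by blast
        then show "{u, v} \<notin> E" using x_independent[of j k] by simp
      qed
      then show ?thesis
        unfolding edge_ideal_monomial_span Q_def monomial_span_def by blast
    qed
    moreover have "Q i \<subset> Q (Suc i)" if i: "i < t" for i
    proof
      show "Q i \<subseteq> Q (Suc i)" by (fastforce simp: Q_def monomial_span_def)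
      have "x (Suc i) \<notin> x ` {Suc i<..t}"
        using i by (subst inj_on_image_mem_iff[OF x_inj]) auto
      moreover have "x (Suc i) \<in> V" "x (Suc i) \<in> x ` {i<..t}" using i V_eq by auto
      ultimately have "mvar (x (Suc i)) \<in> Q (Suc i) - Q i"
        by (simp add: Q_def monomial_span_def mem_poly_ring mvar_def)
      then show "Q i \<noteq> Q (Suc i)" by blast
    qed
    ultimately show ?thesis by blast
  qed
  moreover have "n \<le> enat t" if n_chain: "n \<in> ?chains" for n
  proof -
    obtain k Q where n: "n = enat k" and Q: "\<And>i. i \<le> k \<Longrightarrow> primeideal (Q i) (poly_ring V)"
      "\<And>i. i \<le> k \<Longrightarrow> ?I \<subseteq> Q i" "\<And>i. i < k \<Longrightarrow> Q i \<subset> Q (Suc i)"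
      using n_chain by blast
    have "k \<le> t"
    proof (rule prime_chain_length[OF finite_V, where C = 2])
      show "monomial_span V (\<lambda>m. \<not> face_monomial E m) \<subseteq> Q 0"
        using Q(2)[of 0] by (simp add: edge_ideal_monomial_span)
    qed (use card_face_monomials_le Q in auto)
    then show ?thesis by (simp add: n)
  qed
  ultimately have "Sup ?chains = enat t"
    by (intro antisym Sup_least Sup_upper)
  then show ?thesis by (simp only: krull_dim_quotient[OF poly_ring_cring I])
qed

lemma independent_edges_iff:
  assumes S: "S \<subseteq> {1..t}"
  shows "independent_edges E ((\<lambda>i. {x i, y i}) ` S) \<longleftrightarrow> S \<in> independent_indices"
proof
  assume ind: "independent_edges E ((\<lambda>i. {x i, y i}) ` S)"
  have "{x i, y j} \<notin> E \<and> {y i, y j} \<notin> E" if ij: "i \<in> S" "j \<in> S" "i \<noteq> j" for i j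
  proof -
    have "i \<in> {1..t}" "j \<in> {1..t}" using ij S by auto
    then have "x i \<noteq> x j" "x i \<noteq> y j"
      using x_neq_y inj_onD[OF x_inj, of i j] ij(3) by blast+
    then have "{x i, y i} \<noteq> {x j, y j}" by (auto simp: doubleton_eq_iff)
    then have "\<not> (\<exists>u\<in>{x i, y i}. \<exists>v\<in>{x j, y j}. {u, v} \<in> E)"
      using ind[unfolded independent_edges_def, THEN bspec, OF imageI[OF ij(1)],
          THEN bspec, OF imageI[OF ij(2)]] by simp
    then show ?thesis by simp
  qed
  then show "S \<in> independent_indices" using S by (simp add: independent_indices_def)
next
  assume ind: "S \<in> independent_indices"
  show "independent_edges E ((\<lambda>i. {x i, y i}) ` S)"
    unfolding independent_edges_def
  proof (intro ballI impI notI)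
    fix e f assume e: "e \<in> (\<lambda>i. {x i, y i}) ` S" and f: "f \<in> (\<lambda>i. {x i, y i}) ` S" and "e \<noteq> f"
      and uv: "\<exists>u\<in>e. \<exists>v\<in>f. {u, v} \<in> E"
    then obtain i j where ij: "i \<in> S" "j \<in> S" "e = {x i, y i}" "f = {x j, y j}" "i \<noteq> j" by blast
    then have "{x i, x j} \<notin> E" using x_independent S by blast
    moreover have "{x i, y j} \<notin> E" "{x j, y i} \<notin> E" "{y i, y j} \<notin> E"
      using ind ij by (auto simp: independent_indices_def)
    ultimately show False using uv ij by (auto simp: insert_commute)
  qed
qed

lemma card_independent_matchings:
  "card {S. S \<subseteq> (\<lambda>i. {x i, y i}) ` {1..t} \<and> card S = k \<and> independent_edges E S}
    = card {S \<in> independent_indices. card S = k}"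
proof -
  let ?e = "\<lambda>i. {x i, y i}"
  have inj: "inj_on ?e {1..t}"
  proof (rule inj_onI)
    fix i j assume ij: "i \<in> {1..t}" "j \<in> {1..t}" "{x i, y i} = {x j, y j}"
    then have "x i \<noteq> y j" using x_neq_y by blast
    then have "x i = x j" using ij(3) by (auto simp: doubleton_eq_iff)
    then show "i = j" using inj_onD[OF x_inj] ij by blast
  qed
  have card: "card (?e ` S) = card S" if "S \<subseteq> {1..t}" for S
    by (rule card_image[OF inj_on_subset[OF inj that]])
  have sub: "S \<subseteq> {1..t}" if "S \<in> independent_indices" for S
    using that by (simp add: independent_indices_def)
  have image: "(`) ?e ` {S \<in> independent_indices. card S = k}
      = {S. S \<subseteq> ?e ` {1..t} \<and> card S = k \<and> independent_edges E S}"
  proof (intro subset_antisym subsetI)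
    fix W assume "W \<in> (`) ?e ` {S \<in> independent_indices. card S = k}"
    then obtain S where S: "S \<in> independent_indices" "card S = k" "W = ?e ` S" by auto
    then show "W \<in> {S. S \<subseteq> ?e ` {1..t} \<and> card S = k \<and> independent_edges E S}"
      using card[OF sub[OF S(1)]] independent_edges_iff[OF sub[OF S(1)]] image_mono[OF sub[OF S(1)], of ?e]
      by simp
  next
    fix W assume W: "W \<in> {S. S \<subseteq> ?e ` {1..t} \<and> card S = k \<and> independent_edges E S}"
    then obtain S where S: "S \<subseteq> {1..t}" "W = ?e ` S" by (auto simp: subset_image_iff)
    then show "W \<in> (`) ?e ` {S \<in> independent_indices. card S = k}"
      using W card[OF S(1)] independent_edges_iff[OF S(1)] by auto
  qed
  have "inj_on ((`) ?e) {S \<in> independent_indices. card S = k}"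
    by (rule inj_on_subset[OF inj_on_image_Pow[OF inj]]) (use sub in auto)
  from card_image[OF this] show ?thesis unfolding image .
qed

lemma h_vector_edge_ideal:
  "h_vector V (edge_ideal V E :: ('v, 'k::field) mpoly set) k
    = int (card {S \<in> independent_indices. card S = k})"
proof -
  have "h_vector V (edge_ideal V E :: ('v, 'k) mpoly set) k
      = fps_nth (\<Sum>S\<in>independent_indices. fps_X ^ card S) k"
    by (simp add: h_vector_def krull_dim_edge_ideal hilbert_series_edge_ideal)
  also have "\<dots> = (\<Sum>S\<in>independent_indices. if card S = k then 1 else 0)"
    unfolding fps_sum_nth by (intro sum.cong) (auto simp: fps_X_power_nth)
  also have "\<dots> = int (card {S \<in> independent_indices. card S = k})"
    using finite_independent_indices by (simp add: sum.If_cases Int_def)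
  finally show ?thesis .
qed

end

theorem theorem7p5:
  fixes V :: "'v set" and E :: "'v set set" and M :: "'v set set"
    and x y :: "nat \<Rightarrow> 'v" and t :: nat
  assumes "finite_graph V E" and "loopless E"
    and "M = (\<lambda>i. {x i, y i}) ` {1..t}"
    and "perfect_matching V E M"
    and "property_P V E M"
    and "\<forall>i\<in>{2..t}. neighbors E (x i) \<inter> (\<Union>j\<in>{1..<i}. {x j, y j}) = {}"
  shows "\<forall>i. h_vector V (edge_ideal V E :: ('v, 'k::field) mpoly set) i
               = int (card {S. S \<subseteq> M \<and> card S = i \<and> independent_edges E S})"
proof -
  have edge: "{x i, y i} \<in> E" if "i \<in> {1..t}" for i
    using assms(3,4) that by (auto simp: perfect_matching_def matching_def)
  have in_V: "u \<in> V" "v \<in> V" if "{u, v} \<in> E" for u v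
    using assms(1) that by (fastforce simp: finite_graph_def doubleton_eq_iff)+
  have loop: "{v} \<notin> E" for v using assms(2) by (simp add: loopless_def)
  have later: "{x i, x j} \<notin> E" "{x i, y j} \<notin> E" if "i \<in> {1..t}" "j \<in> {1..t}" "j < i" for i j
  proof -
    have "neighbors E (x i) \<inter> (\<Union>j\<in>{1..<i}. {x j, y j}) = {}" "j \<in> {1..<i}"
      using assms(6) that by auto
    then have "x j \<notin> neighbors E (x i)" "y j \<notin> neighbors E (x i)" by blast+
    then show "{x i, x j} \<notin> E" "{x i, y j} \<notin> E" by (simp_all add: neighbors_def insert_commute)
  qed
  have x_ne: "x i \<noteq> x j" and y_ne: "y i \<noteq> y j" if "i \<in> {1..t}" "j \<in> {1..t}" "j < i" for i j
    using later[OF that] edge[of i] edge[of j] that by auto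
  interpret ordered_perfect_matching V E x y t
  proof
    show "V = x ` {1..t} \<union> y ` {1..t}"
    proof
      show "V \<subseteq> x ` {1..t} \<union> y ` {1..t}"
        using assms(3,4) unfolding perfect_matching_def by blast
      show "x ` {1..t} \<union> y ` {1..t} \<subseteq> V" using in_V edge by blast
    qed
    show "inj_on x {1..t}"
      by (rule linorder_inj_onI') (use x_ne in metis)
    show "inj_on y {1..t}"
      by (rule linorder_inj_onI') (use y_ne in metis)
    have "x i \<noteq> y j" if ij: "i \<in> {1..t}" "j \<in> {1..t}" for i j
    proof (cases i j rule: linorder_cases)
      case less
      then show ?thesis using later(1)[of j i] edge[of j] ij by (auto simp: insert_commute)
    next
      case equal
      then show ?thesis using edge[of i] ij loop by auto
    next
      case greater
      then show ?thesis using later(1)[of i j] edge[of j] ij by (auto simp: insert_commute)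
    qed
    then show "x ` {1..t} \<inter> y ` {1..t} = {}" by blast
    show "{a, b} \<in> E" if "i \<in> {1..t}" "a \<in> V" "b \<in> V" "{a, x i} \<in> E" "{y i, b} \<in> E" for i a b
    proof -
      have "edge_property_P V E {x i, y i}" using assms(3,5) that(1) by (auto simp: property_P_def)
      then show ?thesis using that unfolding edge_property_P_def by blast
    qed
  qed (use assms(1,2) edge later in auto)
  show ?thesis
    unfolding assms(3) card_independent_matchings using h_vector_edge_ideal by blast
qed

end
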